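(* Let $k=k(n)\in\{1,\dots,n\}$ satisfy $k=o((n/\log n)^{1/2})$ as $n\to\infty$. For the cyclic-to-random transposition shuffle there exists a constant $C>0$ such that for all $n$ sufficiently large, $$t_{\mathrm{mix}}^k(1/4)\le 0.5006\,n(\log k+C).$$
   Context: Notation: $[n]=\{1,\dots,n\}$. A permutation $\sigma\in S_n$ is an arrangement of $n$ labelled cards in locations $1,\dots,n$ of a deck; $\sigma^{-1}(i)$ is the location of the card with label $i$. Cyclic-to-random transposition shuffle: at each step $t=1,2,\dots$ the left hand chooses the location $L_t= t \bmod n$ (representative in $[n]$), the right hand chooses a location $R_t$ uniform on $[n]$, independently of all past choices, and the cards in locations $L_t$ and $R_t$ are swapped (nothing changes if $L_t=R_t$). $\sigma_t$ denotes the permutation at time $t$ started at time $0$ from $\sigma_0$, and $\pi$ a uniform random permutation. For distinct cards $c_1,\dots,c_k\in[n]$, $\mu^{\sigma}_{c_1,\dots,c_k}$ denotes the joint law of the locations $(\sigma^{-1}(c_1),\dots,\sigma^{-1}(c_k))$ in a random permutation $\sigma$. Define $$d_{c_1,\dots,c_k}(t)=\max_{\sigma_0\in S_n}\|\mu^{\sigma_t}_{c_1,\dots,c_k}-\mu^{\pi}_{c_1,\dots,c_k}\|_{\mathrm{TV}},$$ where $\|\cdot\|_{\mathrm{TV}}$ is total variation distance. Let $\Omega_k$ be the set of all subsets of $[n]$ of size $k$. The $k$-partial mixing time at level $\varepsilon$ is $$t_{\mathrm{mix}}^k(\varepsilon)=\min\Big\{t\ge 0:\ \max_{\{c_1,\dots,c_k\}\in\Omega_k}d_{c_1,\dots,c_k}(t)<\varepsilon\Big\},$$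 with $t$ ranging over non-negative integers. *)

theory Defs
  imports
    "HOL-Probability.Probability"
    "HOL-Combinatorics.Permutations"
    "HOL-Library.Landau_Symbols"
    "HOL-Library.Extended_Nat"
begin

text \<open>
  A deck of \<open>n\<close> cards is a permutation \<open>\<sigma>\<close> of \<open>{1..n}\<close>: \<open>\<sigma> i\<close> is the label of the card in
  location \<open>i\<close>, and \<open>inv \<sigma> c\<close> is the location of the card with label \<open>c\<close>.
\<close>

definition left_hand :: "nat \<Rightarrow> nat \<Rightarrow> nat" where
  "left_hand n t = (if t mod n = 0 then n else t mod n)"

text \<open>
  Swapping the cards in locations \<open>L\<close> and \<open>R\<close> composes with the transposition on the right,
  since decks map locations to labels.
\<close>

primrec shuffle :: "nat \<Rightarrow> (nat \<Rightarrow> nat) \<Rightarrow> nat \<Rightarrow> (nat \<Rightarrow> nat) pmf" where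
  "shuffle n \<sigma>\<^sub>0 0 = return_pmf \<sigma>\<^sub>0"
| "shuffle n \<sigma>\<^sub>0 (Suc t) =
     bind_pmf (shuffle n \<sigma>\<^sub>0 t) (\<lambda>\<sigma>.
       map_pmf (\<lambda>R. \<sigma> \<circ> Transposition.transpose (left_hand n (Suc t)) R) (pmf_of_set {1..n}))"

definition uniform_deck :: "nat \<Rightarrow> (nat \<Rightarrow> nat) pmf" where
  "uniform_deck n = pmf_of_set {\<sigma>. \<sigma> permutes {1..n}}"

definition card_locations :: "nat list \<Rightarrow> (nat \<Rightarrow> nat) pmf \<Rightarrow> nat list pmf" where
  "card_locations cs p = map_pmf (\<lambda>\<sigma>. map (inv \<sigma>) cs) p"

definition tv_dist :: "'a pmf \<Rightarrow> 'a pmf \<Rightarrow> real" where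
  "tv_dist p q = (SUP A. \<bar>measure_pmf.prob p A - measure_pmf.prob q A\<bar>)"

definition worst_dist :: "nat \<Rightarrow> nat list \<Rightarrow> nat \<Rightarrow> real" where
  "worst_dist n cs t =
     Max ((\<lambda>\<sigma>\<^sub>0. tv_dist (card_locations cs (shuffle n \<sigma>\<^sub>0 t)) (card_locations cs (uniform_deck n)))
       ` {\<sigma>\<^sub>0. \<sigma>\<^sub>0 permutes {1..n}})"

definition Omega :: "nat \<Rightarrow> nat \<Rightarrow> nat set set" where
  "Omega n k = {A. A \<subseteq> {1..n} \<and> card A = k}"

text \<open>
  The maximum over \<open>k\<close>-subsets ranges over all repetition-free enumerations of such subsets.
  The infimum in \<^typ>\<open>enat\<close> is the minimum if the level is reached, and \<open>\<infinity>\<close> otherwise.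
\<close>

definition partial_mixing_time :: "nat \<Rightarrow> nat \<Rightarrow> real \<Rightarrow> enat" where
  "partial_mixing_time n k \<epsilon> =
     Inf (enat ` {t. Max ((\<lambda>cs. worst_dist n cs t) ` {cs. distinct cs \<and> set cs \<in> Omega n k}) < \<epsilon>})"

end

theory Submission
  imports Defs
begin

text \<open>
  Let \<open>q\<^sub>t y\<close> be the probability that a single card is in location \<open>y\<close> at time \<open>t\<close>, minus \<open>1/n\<close>.
  A step of the shuffle resets \<open>q\<close> to \<open>0\<close> at the location of the left hand, so the values of \<open>q\<close>
  seen by the left hand obey a scalar renewal equation. Its dominant mode, which decays like
  \<open>exp (- t / n)\<close>, is excluded by \<open>\<Sum>y. q\<^sub>t y = 0\<close>; with this constraint the single card mixes
  at least as fast as \<open>exp (- 2 t / n)\<close>, and \<open>1/2 < 0.5006\<close>.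

  As \<open>k\<^sup>2 log n = o(n)\<close>, during \<open>O(n log n)\<close> steps the two hands hardly ever meet two of the \<open>k\<close> cards
  at once, so the \<open>k\<close> locations are close to \<open>k\<close> independent single-card chains, hence to independent
  uniform locations. The law of the \<open>k\<close> locations in a uniform deck is compared with the same product
  law by averaging the estimate over the initial deck, since the uniform deck is stationary.
\<close>

subsection \<open>The single card: a renewal equation\<close>


lemma left_hand_in: "0 < n \<Longrightarrow> left_hand n t \<in> {1..n}"
  unfolding left_hand_def by (auto simp: Suc_le_eq intro: less_imp_le)

lemma left_hand_mod: "left_hand n t mod n = t mod n"
  unfolding left_hand_def by auto

lemma left_hand_add_period: "left_hand n (t + n) = left_hand n t"
  unfolding left_hand_def by simp

lemma left_hand_inj_on: "inj_on (\<lambda>j. left_hand n (t + j)) {..<n}"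
proof (rule linorder_inj_onI')
  fix i j assume ij: "i \<in> {..<n}" "j \<in> {..<n}" "i < j"
  show "left_hand n (t + i) \<noteq> left_hand n (t + j)"
  proof
    assume "left_hand n (t + i) = left_hand n (t + j)"
    then have "(t + j) mod n = (t + i) mod n" by (metis left_hand_mod)
    then have "n dvd (t + j) - (t + i)" using ij by (subst (asm) mod_eq_dvd_iff_nat) auto
    then show False using ij dvd_imp_le[of n "j - i"] by auto
  qed
qed

lemma left_hand_bij_betw:
  assumes "0 < n"
  shows "bij_betw (\<lambda>j. left_hand n (t + j)) {..<n} {1..n}"
proof -
  have "(\<lambda>j. left_hand n (t + j)) ` {..<n} = {1..n}"
    using left_hand_in[OF assms] left_hand_inj_on[of n t]
    by (intro card_subset_eq) (auto simp: card_image)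
  then show ?thesis using left_hand_inj_on by (simp add: bij_betw_def)
qed

text \<open>Any \<open>n\<close> consecutive steps visit every location once, so a sum over
  locations may be read as a sum over one round of steps. This turns the mean-zero constraint into a
  relation between hits.\<close>

lemma sum_left_hand:
  assumes "0 < n"
  shows "(\<Sum>j<n. f (left_hand n (t + j))) = (\<Sum>y=1..n. f y)"
  using sum.reindex_bij_betw[OF left_hand_bij_betw[OF assms, of t], of f] by simp

lemma left_hand_neq:
  assumes "0 < j" "j < n"
  shows "left_hand n (t + j) \<noteq> left_hand n t"
  using inj_onD[OF left_hand_inj_on[of n t], of j 0] assms by auto

section \<open>The mass of the tilted signed kernel\<close>

text \<open>On \<open>[0,1]\<close> the Taylor terms of order 3 to 5 are absorbed into
  \<open>v^2\<close>; with \<open>exp 1 \<le> 3\<close> the coefficients add up to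
  \<open>1/2 + 1/6 + 1/24 + 3/120 < 3/4\<close>.\<close>

lemma exp_le_quadratic:
  fixes v :: real
  assumes "0 \<le> v" "v \<le> 1"
  shows "exp v \<le> 1 + v + 3/4 * v\<^sup>2"
proof -
  obtain t where t: "\<bar>t\<bar> \<le> \<bar>v\<bar>" "exp v = (\<Sum>m<5. v ^ m / fact m) + exp t / fact 5 * v ^ 5"
    using Maclaurin_exp_le[of v 5] by blast
  have "exp t \<le> exp 1" using t(1) assms by simp
  then have "exp t \<le> 3" using exp_le by linarith
  then have "exp t * v ^ 5 \<le> 3 * v ^ 5" using assms by (intro mult_right_mono) auto
  moreover have "0 \<le> v ^ 2" "v ^ 5 \<le> v ^ 2" "v ^ 4 \<le> v ^ 2" "v ^ 3 \<le> v ^ 2"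
    using assms by (auto intro: power_decreasing)
  moreover have "exp v = 1 + v + v^2 / 2 + v^3 / 6 + v^4 / 24 + exp t * v ^ 5 / 120"
    unfolding t(2) by (simp add: eval_nat_numeral)
  ultimately show ?thesis by linarith
qed

text \<open>The left Riemann sum of an increasing function is below its integral; the inductive step
  is Bernoulli's inequality.\<close>

lemma sum_power_le: "(\<Sum>i<n. real i ^ p) * real (Suc p) \<le> real n ^ Suc p"
proof (induction n)
  case (Suc n)
  have "1 + real (Suc p) * (1 / real n) \<le> (1 + 1 / real n) ^ Suc p" if "n > 0"
    by (rule Bernoulli_inequality) (use that in \<open>auto simp: field_simps\<close>)
  then have "(1 + real (Suc p) * (1 / real n)) * real n ^ Suc p
      \<le> (1 + 1 / real n) ^ Suc p * real n ^ Suc p" if "n > 0"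
    using that by (intro mult_right_mono) auto
  also have "\<dots> = real (Suc n) ^ Suc p" if "n > 0"
    using that by (simp add: power_mult_distrib[symmetric] field_simps del: power_Suc)
  also have "(1 + real (Suc p) * (1 / real n)) * real n ^ Suc p = real n ^ Suc p + real (Suc p) * real n ^ p"
    if "n > 0"
    using that by (simp add: field_simps)
  finally have "real n ^ Suc p + real (Suc p) * real n ^ p \<le> real (Suc n) ^ Suc p" if "n > 0"
    using that by blast
  moreover have "real n ^ Suc p + real (Suc p) * real n ^ p \<le> real (Suc n) ^ Suc p" if "n = 0"
    using that by (cases p) auto
  ultimately have "real n ^ Suc p + real (Suc p) * real n ^ p \<le> real (Suc n) ^ Suc p" by blast
  then show ?case using Suc by (simp add: algebra_simps)
qed simp

text \<open>
  The quartic is \<open>(7/25 + 25/28 x\<^sup>2) (1 + v + 3/4 v\<^sup>2)\<close> with \<open>x = 1 - 5/3 (1 - v)\<close>; the AM-GM weight and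
  the slope \<open>5/3\<close> are chosen so that its integral over \<open>[0,1]\<close> is below 1.
\<close>

lemma kernel_pointwise_bound:
  fixes v :: real
  assumes "0 \<le> v" "v \<le> 1"
  shows "\<bar>1 - 5/3 * (1 - v)\<bar> * exp v \<le>
    (17056 - 32944 * v + 25292 * v^2 + 25000 * v^3 + 46875 * v^4) / 25200"
proof -
  define x where "x = 1 - 5/3 * (1 - v)"
  have "0 \<le> (\<bar>x\<bar> - 14/25)\<^sup>2" by simp
  then have "\<bar>x\<bar> \<le> 7/25 + x\<^sup>2 * (25/28)"
    by (simp add: power2_diff power2_abs) (simp add: power2_eq_square)
  then have "\<bar>x\<bar> * exp v \<le> (7/25 + x\<^sup>2 * (25/28)) * (1 + v + 3/4 * v\<^sup>2)"
    using exp_le_quadratic[OF assms] by (intro mult_mono) auto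
  also have "\<dots> = (17056 - 32944 * v + 25292 * v^2 + 25000 * v^3 + 46875 * v^4) / 25200"
    unfolding x_def by (simp add: field_simps eval_nat_numeral)
  finally show ?thesis unfolding x_def .
qed


text \<open>With \<open>v = (i + 1) / n\<close> the left side is at most \<open>exp (1 / n)\<close>
  times a Riemann sum of the quartic. For \<open>n \<ge> 100\<close> the Riemann sum is at most
  0.985 and the factor at most 1.0101, so the product stays below 1.\<close>

lemma kernel_weight_le_one:
  assumes "100 \<le> n"
  shows "(\<Sum>i<n-1. \<bar>1 - 5/3 * real (n-1-i) / real n\<bar> * exp ((real i + 2) / real n)) / real n \<le> 1"
proof -
  define P where "P v = (17056 - 32944 * v + 25292 * v^2 + 25000 * v^3 + 46875 * v^4) / 25200" for v :: real
  have n: "real n > 0" using assms by simp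
  have summand: "\<bar>1 - 5/3 * real (n-1-i) / real n\<bar> * exp ((real i + 2) / real n)
      \<le> exp (1 / real n) * P (real (Suc i) / real n)" if "i < n - 1" for i
  proof -
    have e: "1 - real (Suc i) / real n = real (n-1-i) / real n"
      using that by (simp add: field_simps of_nat_diff)
    have "\<bar>1 - 5/3 * (1 - real (Suc i) / real n)\<bar> * exp (real (Suc i) / real n) \<le> P (real (Suc i) / real n)"
      unfolding P_def using that by (intro kernel_pointwise_bound) (auto simp: field_simps)
    moreover have "exp ((real i + 2) / real n) = exp (1 / real n) * exp (real (Suc i) / real n)"
      by (simp add: exp_add[symmetric] add_divide_distrib[symmetric])
    ultimately show ?thesis unfolding e by simp
  qed
  define M where "M p = (\<Sum>i<n. (real i / real n) ^ p) / real n" for p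
  have m: "M p \<le> 1 / real (Suc p)" for p
  proof -
    have "M p = (\<Sum>i<n. real i ^ p) / real n ^ Suc p"
      by (simp add: M_def power_divide sum_divide_distrib[symmetric])
    also have "\<dots> \<le> 1 / real (Suc p)"
      using sum_power_le[where n = n and p = p] n by (simp add: field_simps del: of_nat_Suc)
    finally show ?thesis .
  qed
  \<comment> \<open>The first moment is computed exactly: its coefficient in the quartic is
    negative, so the upper bound \<open>m\<close> would point the wrong way.\<close>
  have m1: "(\<Sum>i<n. real i / real n) / real n = 1/2 - 1 / (2 * real n)"
  proof -
    have "2 * (\<Sum>i<n. real i) = real n * (real n - 1)"
      by (induction n) (auto simp: algebra_simps)
    then have "(\<Sum>i<n. real i) = real n * (real n - 1) / 2" by simp
    then show ?thesis using n by (simp add: sum_divide_distrib[symmetric] field_simps)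
  qed
  have "(\<Sum>i<n-1. P (real (Suc i) / real n)) / real n \<le> (\<Sum>i<n. P (real i / real n)) / real n"
  proof -
    have "(\<Sum>i<n. P (real i / real n)) = P 0 + (\<Sum>i<n-1. P (real (Suc i) / real n))"
      using sum.lessThan_Suc_shift[of "\<lambda>i. P (real i / real n)" "n - 1"] assms by simp
    moreover have "P 0 \<ge> 0" by (simp add: P_def)
    ultimately show ?thesis by (simp add: divide_right_mono)
  qed
  also have "(\<Sum>i<n. P (real i / real n)) = (17056 * real n - 32944 * (\<Sum>i<n. real i / real n)
      + 25292 * (\<Sum>i<n. (real i / real n) ^ 2) + 25000 * (\<Sum>i<n. (real i / real n) ^ 3)
      + 46875 * (\<Sum>i<n. (real i / real n) ^ 4)) / 25200"
    unfolding P_def sum_divide_distrib[symmetric] sum.distrib sum_subtractf sum_distrib_left[symmetric]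
    by simp
  also have "\<dots> / real n = (17056 * (real n / real n) - 32944 * ((\<Sum>i<n. real i / real n) / real n)
      + 25292 * M 2 + 25000 * M 3 + 46875 * M 4) / 25200"
  proof -
    have "(17056 * real n - 32944 * a + 25292 * b + 25000 * c + 46875 * d) / 25200 / real n
        = (17056 * (real n / real n) - 32944 * (a / real n) + 25292 * (b / real n) + 25000 * (c / real n)
          + 46875 * (d / real n)) / 25200" for a b c d :: real
      using n by (simp add: field_simps)
    then show ?thesis unfolding M_def .
  qed
  also have "\<dots> = (17056 - 32944 * (1/2 - 1 / (2 * real n)) + 25292 * M 2 + 25000 * M 3 + 46875 * M 4) / 25200"
    unfolding m1 using n by simp
  also have "\<dots> \<le> (17056 - 32944 * (1/2 - 1 / (2 * real n)) + 25292 / 3 + 25000 / 4 + 46875 / 5) / 25200"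
    using m[of 2] m[of 3] m[of 4] by simp
  also have "\<dots> \<le> 985 / 1000"
    using assms by (simp add: field_simps)
  finally have S: "(\<Sum>i<n-1. P (real (Suc i) / real n)) / real n \<le> 985 / 1000" .
  have "exp (1 / real n) \<le> 1 + 1 / real n + (1 / real n)\<^sup>2"
    using assms by (intro exp_bound) auto
  also have "\<dots> \<le> 1 + 1/100 + (1/100)\<^sup>2"
    using assms by (intro add_mono power_mono) (auto simp: field_simps)
  finally have E: "exp (1 / real n) \<le> 1 + 1/100 + (1/100)\<^sup>2" .
  have "(\<Sum>i<n-1. \<bar>1 - 5/3 * real (n-1-i) / real n\<bar> * exp ((real i + 2) / real n)) / real n
      \<le> exp (1 / real n) * ((\<Sum>i<n-1. P (real (Suc i) / real n)) / real n)"
    using summand n by (auto simp: sum_distrib_left intro!: divide_right_mono sum_mono)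
  also have "\<dots> \<le> exp (1 / real n) * (985 / 1000)"
    using S by (intro mult_left_mono) auto
  also have "\<dots> \<le> 1" using E by (simp add: power2_eq_square)
  finally show ?thesis .
qed

text \<open>Exchanging the sums, \<open>f i\<close> occurs once for each
  \<open>j < m - i\<close>.\<close>

lemma sum_triangle:
  "(\<Sum>j<Suc m. \<Sum>i<m - j. f i) = (\<Sum>i<m. real (m - i) * f i)"
proof (induction m)
  case (Suc m)
  have "(\<Sum>j<Suc (Suc m). \<Sum>i<Suc m - j. f i) = (\<Sum>i<Suc m. f i) + (\<Sum>i<m. real (m - i) * f i)"
    unfolding Suc.IH[symmetric] by (subst sum.lessThan_Suc_shift) simp
  also have "\<dots> = (\<Sum>i<Suc m. real (Suc m - i) * f i)"
  proof -
    have "(\<Sum>i<m. real (Suc m - i) * f i) = (\<Sum>i<m. f i + real (m - i) * f i)"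
      by (intro sum.cong) (auto simp: Suc_diff_le algebra_simps)
    then show ?thesis by (simp add: sum.distrib)
  qed
  finally show ?case .
qed simp

section \<open>Decay for solutions of the recurrence\<close>

text \<open>The left hand's location receives the content of a uniform location, so its deviation
  becomes 0. Any other \<open>y\<close> keeps its content unless the right hand picks it, with
  probability \<open>1/n\<close>, and then takes what was under the left hand. The bound 2 is the
  largest possible mass of a difference of two probability vectors.\<close>

locale sweep_recurrence =
  fixes n :: nat and q :: "nat \<Rightarrow> nat \<Rightarrow> real"
  assumes n_ge: "100 \<le> n"
    and step: "\<And>t y. y \<in> {1..n} \<Longrightarrow> q (Suc t) y =
      (if y = left_hand n (Suc t) then 0
       else (1 - 1 / real n) * q t y + q t (left_hand n (Suc t)) / real n)"
    and mean_zero: "\<And>t. (\<Sum>y=1..n. q t y) = 0"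
    and init: "(\<Sum>y=1..n. \<bar>q 0 y\<bar>) \<le> 2"
begin

text \<open>The deviation is read just before step \<open>Suc t\<close> erases it. These values form
  the only input that the other locations receive.\<close>

definition hit :: "nat \<Rightarrow> real" where
  "hit t = q t (left_hand n (Suc t))"

abbreviation g :: real where
  "g \<equiv> 1 - 1 / real n"

lemma n_pos: "0 < n" using n_ge by simp

lemma g_nonneg: "0 \<le> g" and g_le_one: "g \<le> 1"
  using n_ge by (auto simp: field_simps)

text \<open>The recurrence is solved from the reset at step \<open>Suc t\<close> on. As
  \<open>j < n\<close>, the left hand has not returned, and since the reset value is 0 nothing older
  enters.\<close>

lemma after_hit:
  assumes "j < n"
  shows "q (Suc t + j) (left_hand n (Suc t)) = (\<Sum>i<j. g ^ i * hit (t + j - i)) / real n"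
  using assms
proof (induction j)
  case 0
  then show ?case using step[OF left_hand_in[OF n_pos, of "Suc t"], of t] by simp
next
  case (Suc j)
  have "left_hand n (Suc t) \<noteq> left_hand n (Suc (Suc t + j))"
    using left_hand_neq[of "Suc j" n "Suc t"] Suc.prems by simp
  then have "q (Suc (Suc t + j)) (left_hand n (Suc t)) =
      g * ((\<Sum>i<j. g ^ i * hit (t + j - i)) / real n) + hit (Suc t + j) / real n"
    using step[OF left_hand_in[OF n_pos, of "Suc t"], of "Suc t + j"] Suc by (simp add: hit_def)
  also have "\<dots> = (\<Sum>i<Suc j. g ^ i * hit (t + Suc j - i)) / real n"
    by (subst sum.lessThan_Suc_shift) (simp add: sum_distrib_left add_divide_distrib mult.assoc)
  finally show ?case by simp
qed

text \<open>The location visited at step \<open>Suc t + j\<close> has age \<open>n - 1 - j\<close>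
  at time \<open>t + n\<close>, so one full round expresses every deviation through the hits of that
  round.\<close>

lemma after_round:
  assumes "j < n"
  shows "q (t + n) (left_hand n (Suc t + j)) = (\<Sum>i<n - 1 - j. g ^ i * hit (t + n - 1 - i)) / real n"
proof -
  have "Suc (t + j) + (n - 1 - j) = t + n" "t + j + (n - 1 - j) = t + n - 1" using assms by auto
  then show ?thesis using after_hit[of "n - 1 - j" "t + j"] assms by simp
qed

text \<open>The case \<open>j = 0\<close>, whose location is next to be visited again: the hits
  satisfy a closed renewal equation.\<close>

lemma hit_average: "hit (t + n) = (\<Sum>i<n - 1. g ^ i * hit (t + n - 1 - i)) / real n"
  using after_round[of 0 t] n_pos left_hand_add_period[of n "Suc t"] by (simp add: hit_def)

text \<open>The deviations at time \<open>t + n\<close> sum to 0. By \<open>after_round\<close> the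
  hit of index \<open>i\<close> contributes to the \<open>n - 1 - i\<close> locations that were
  reset before it.\<close>

lemma hit_moment: "(\<Sum>i<n - 1. real (n - 1 - i) * (g ^ i * hit (t + n - 1 - i))) = 0"
proof -
  define f where "f i = g ^ i * hit (t + n - 1 - i)" for i
  have "0 = (\<Sum>j<n. q (t + n) (left_hand n (Suc t + j)))"
    using sum_left_hand[OF n_pos, of "q (t + n)" "Suc t"] mean_zero by simp
  also have "\<dots> = (\<Sum>j<Suc (n - 1). \<Sum>i<n - 1 - j. f i) / real n"
    using after_round[of _ t] n_pos by (simp add: f_def sum_divide_distrib)
  finally show ?thesis unfolding sum_triangle using n_pos by (simp add: f_def)
qed

text \<open>
  The vanishing first moment may be subtracted from the averaging kernel; the resulting signed kernel
  has total mass below 1 even after it is tilted by the exponential weight, which the positive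
  kernel alone has not.
\<close>

lemma hit_signed_average:
  "hit (t + n) = (\<Sum>i<n - 1. (1 - 5/3 * real (n-1-i) / real n) * (g ^ i * hit (t + n - 1 - i))) / real n"
proof -
  have "(\<Sum>i<n - 1. (1 - 5/3 * real (n-1-i) / real n) * (g ^ i * hit (t + n - 1 - i)))
    = (\<Sum>i<n - 1. g ^ i * hit (t + n - 1 - i))
      - 5/3 / real n * (\<Sum>i<n - 1. real (n - 1 - i) * (g ^ i * hit (t + n - 1 - i)))"
    unfolding sum_distrib_left sum_subtractf[symmetric]
    by (intro sum.cong refl) (simp add: left_diff_distrib)
  then show ?thesis unfolding hit_moment using hit_average by simp
qed

lemma g_power_le: "g ^ i \<le> exp (- real i / real n)"
proof -
  have "g \<le> exp (- 1 / real n)" using exp_ge_add_one_self[of "- 1 / real n"] by simp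
  then have "g ^ i \<le> exp (- 1 / real n) ^ i" by (intro power_mono g_nonneg)
  then show ?thesis by (simp add: exp_of_nat_mult[symmetric])
qed

text \<open>In the first round the initial values are not yet erased, so the hits are controlled by
  a discrete Gronwall argument: growth \<open>(1 + 1/n)^n \<le> exp 1\<close> acts on initial mass
  at most 2. At time \<open>n\<close> every location has been reset, and \<open>after_round\<close>
  turns the bound on hits into one on \<open>q\<close>.\<close>

lemma hit_sum_first_round: "(\<Sum>s<n. \<bar>hit s\<bar>) \<le> 2 * exp 1"
  and q_first_round: "y \<in> {1..n} \<Longrightarrow> \<bar>q n y\<bar> \<le> 2 * exp 1 / real n"
proof -
  define A where "A t = (\<Sum>s<t. \<bar>hit s\<bar>)" for t
  have q_le: "\<bar>q t y\<bar> \<le> \<bar>q 0 y\<bar> + A t / real n" if y: "y \<in> {1..n}" for t y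
  proof (induction t)
    case (Suc t)
    have "\<bar>q (Suc t) y\<bar> \<le> \<bar>q t y\<bar> + \<bar>hit t\<bar> / real n"
    proof -
      have "\<bar>g * q t y + hit t / real n\<bar> \<le> g * \<bar>q t y\<bar> + \<bar>hit t\<bar> / real n"
        using g_nonneg by (intro order.trans[OF abs_triangle_ineq]) (simp add: abs_mult)
      also have "\<dots> \<le> \<bar>q t y\<bar> + \<bar>hit t\<bar> / real n"
        using g_le_one g_nonneg by (intro add_right_mono mult_left_le_one_le) auto
      finally show ?thesis using step[OF y, of t] by (auto simp: hit_def)
    qed
    then show ?case using Suc by (simp add: A_def add_divide_distrib)
  qed (simp add: A_def)
  \<comment> \<open>Each new hit is at most the initial value at a location not visited before plus
    \<open>A t / n\<close>; over the round these initial values add up to the initial mass.\<close>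
  have A_le: "A t \<le> (1 + 1 / real n) ^ t * (\<Sum>s<t. \<bar>q 0 (left_hand n (Suc s))\<bar>)" for t
  proof (induction t)
    case (Suc t)
    have "A (Suc t) \<le> (1 + 1 / real n) * A t + \<bar>q 0 (left_hand n (Suc t))\<bar>"
      using q_le[OF left_hand_in[OF n_pos, of "Suc t"], of t] by (simp add: A_def hit_def algebra_simps)
    also have "\<dots> \<le> (1 + 1 / real n) * ((1 + 1 / real n) ^ t * (\<Sum>s<t. \<bar>q 0 (left_hand n (Suc s))\<bar>))
        + (1 + 1 / real n) ^ Suc t * \<bar>q 0 (left_hand n (Suc t))\<bar>"
      using Suc one_le_power[of "1 + 1 / real n" "Suc t"]
      by (intro add_mono mult_left_mono) (auto intro!: mult_right_le_one_le simp del: power_Suc simp: mult_le_cancel_right1)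
    also have "\<dots> = (1 + 1 / real n) ^ Suc t * (\<Sum>s<Suc t. \<bar>q 0 (left_hand n (Suc s))\<bar>)"
      by (simp add: algebra_simps)
    finally show ?case .
  qed (simp add: A_def)
  have "(1 + 1 / real n) ^ n \<le> exp (1 / real n) ^ n"
    using exp_ge_add_one_self[of "1 / real n"] by (intro power_mono) auto
  also have "\<dots> = exp 1" using n_pos by (simp add: exp_of_nat_mult[symmetric])
  finally have e: "(1 + 1 / real n) ^ n \<le> exp 1" .
  have i: "(\<Sum>s<n. \<bar>q 0 (left_hand n (Suc s))\<bar>) \<le> 2"
    using sum_left_hand[OF n_pos, of "\<lambda>y. \<bar>q 0 y\<bar>" 1] init by simp
  have "A n \<le> exp 1 * 2"
    using A_le[of n] mult_mono[OF e i] by (auto intro!: sum_nonneg)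
  then show A: "(\<Sum>s<n. \<bar>hit s\<bar>) \<le> 2 * exp 1" by (simp add: A_def)
  show "\<bar>q n y\<bar> \<le> 2 * exp 1 / real n" if "y \<in> {1..n}"
  proof -
    have "y \<in> (\<lambda>j. left_hand n (Suc 0 + j)) ` {..<n}"
      using bij_betw_imp_surj_on[OF left_hand_bij_betw[OF n_pos, of "Suc 0"]] that by simp
    then obtain j where j: "j < n" "y = left_hand n (Suc 0 + j)" by auto
    have "\<bar>\<Sum>i<n - 1 - j. g ^ i * hit (n - 1 - i)\<bar> \<le> (\<Sum>i<n - 1 - j. \<bar>hit (n - 1 - i)\<bar>)"
      using g_nonneg g_le_one
      by (intro order.trans[OF sum_abs] sum_mono) (auto simp: abs_mult power_le_one intro!: mult_left_le_one_le)
    also have "\<dots> \<le> (\<Sum>i<n. \<bar>hit (n - 1 - i)\<bar>)"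
      by (intro sum_mono2) auto
    also have "\<dots> = (\<Sum>s<n. \<bar>hit s\<bar>)"
      using sum.nat_diff_reindex[of "\<lambda>s. \<bar>hit s\<bar>" n] by simp
    finally show ?thesis using A after_round[OF j(1), of 0] j(2)
      by (auto intro!: divide_right_mono)
  qed
qed

text \<open>The weights \<open>g\<close> and \<open>1/n\<close> add up to 1, so each step replaces a
  value by 0 or by a convex combination of old values.\<close>

lemma q_bounded:
  assumes "n \<le> t" "y \<in> {1..n}"
  shows "\<bar>q t y\<bar> \<le> 2 * exp 1 / real n"
  using assms(1) assms(2)
proof (induction t arbitrary: y rule: dec_induct)
  case base
  then show ?case using q_first_round by simp
next
  case (step t)
  have "\<bar>g * q t y + hit t / real n\<bar> \<le> g * \<bar>q t y\<bar> + \<bar>hit t\<bar> / real n"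
    using g_nonneg by (intro order.trans[OF abs_triangle_ineq]) (simp add: abs_mult)
  also have "\<dots> \<le> g * (2 * exp 1 / real n) + (2 * exp 1 / real n) / real n"
    using step.IH[OF step.prems] step.IH[OF left_hand_in[OF n_pos, of "Suc t"]]
    by (intro add_mono mult_left_mono divide_right_mono g_nonneg) (auto simp: hit_def)
  also have "\<dots> = 2 * exp 1 / real n" using n_pos by (simp add: field_simps)
  finally show ?case
    using sweep_recurrence.step[OF sweep_recurrence_axioms step.prems, of t] by (auto simp: hit_def)
qed

text \<open>Strong induction: a hit is a signed average of the hits of the preceding round, and by
  \<open>kernel_weight_le_one\<close> the exponential bound passes through this average without
  loss.\<close>

lemma hit_decay:
  assumes "n \<le> s"
  shows "\<bar>hit s\<bar> \<le> 2 * exp 5 / real n * exp (- 2 * real s / real n)"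
  using assms
proof (induction s rule: less_induct)
  case (less s)
  define K where "K = 2 * exp 5 / real n"
  have K: "K \<ge> 0" by (simp add: K_def)
  show ?case
  proof (cases "s < 2 * n")
    case True
    have "\<bar>hit s\<bar> \<le> 2 * exp 1 / real n"
      using q_bounded[OF less.prems left_hand_in[OF n_pos]] by (simp add: hit_def)
    \<comment> \<open>The constant \<open>exp 5\<close> is set by this range: for
      \<open>s < 2 * n\<close> the exponent \<open>5 - 2 * s / n\<close> is at least 1.\<close>
    also have "2 * exp 1 / real n \<le> 2 * exp (5 - 2 * real s / real n) / real n"
    proof -
      have "real s < 2 * real n" using True by linarith
      then have "2 * real s / real n \<le> 4" using n_pos by (simp add: field_simps)
      then show ?thesis by (intro divide_right_mono) auto
    qed
    also have "\<dots> = 2 * exp 5 / real n * exp (- 2 * real s / real n)"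
      by (simp add: exp_diff exp_minus field_simps)
    finally show ?thesis .
  next
    case False
    define t where "t = s - n"
    have s: "s = t + n" and t: "n \<le> t" using False by (auto simp: t_def)
    define w where "w i = 1 - 5/3 * real (n-1-i) / real n" for i
    have b: "\<bar>w i * (g ^ i * hit (t + n - 1 - i))\<bar>
        \<le> (\<bar>w i\<bar> * exp ((real i + 2) / real n)) * (K * exp (- 2 * real s / real n))"
      if "i < n - 1" for i
    proof -
      have "\<bar>hit (t + n - 1 - i)\<bar> \<le> K * exp (- 2 * real (t + n - 1 - i) / real n)"
        unfolding K_def using that t s by (intro less.IH) auto
      \<comment> \<open>Looking back \<open>i + 1\<close> steps costs
        \<open>exp ((2 * i + 2) / n)\<close>, while \<open>g ^ i\<close> gains
        \<open>exp (- i / n)\<close>. The remaining tilt \<open>exp ((i + 2) / n)\<close> is the one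
        in \<open>kernel_weight_le_one\<close>.\<close>
      also have "- 2 * real (t + n - 1 - i) / real n = - 2 * real s / real n + (2 * real i + 2) / real n"
        using that s n_pos by (simp add: of_nat_diff field_simps)
      finally have h: "\<bar>hit (t + n - 1 - i)\<bar> \<le> K * exp (- 2 * real s / real n + (2 * real i + 2) / real n)" .
      have "\<bar>w i * (g ^ i * hit (t + n - 1 - i))\<bar> = \<bar>w i\<bar> * (g ^ i * \<bar>hit (t + n - 1 - i)\<bar>)"
        using g_nonneg by (simp add: abs_mult)
      also have "\<dots> \<le> \<bar>w i\<bar> * (exp (- real i / real n)
          * (K * exp (- 2 * real s / real n + (2 * real i + 2) / real n)))"
        using h g_power_le[of i] by (intro mult_left_mono mult_mono) auto
      also have "exp (- real i / real n) * (K * exp (- 2 * real s / real n + (2 * real i + 2) / real n))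
          = exp ((real i + 2) / real n) * (K * exp (- 2 * real s / real n))"
      proof -
        have "- real i / real n + (- 2 * real s / real n + (2 * real i + 2) / real n)
            = (real i + 2) / real n + (- 2 * real s / real n)"
          using n_pos by (simp add: field_simps)
        then have "exp (- real i / real n) * exp (- 2 * real s / real n + (2 * real i + 2) / real n)
            = exp ((real i + 2) / real n) * exp (- 2 * real s / real n)"
          unfolding exp_add[symmetric] by (rule arg_cong)
        then show ?thesis by (metis mult.left_commute)
      qed
      finally show ?thesis by (simp add: mult.assoc)
    qed
    have "\<bar>hit s\<bar> = \<bar>\<Sum>i<n - 1. w i * (g ^ i * hit (t + n - 1 - i))\<bar> / real n"
      unfolding s using hit_signed_average[of t] by (simp add: w_def)
    also have "\<dots> \<le> (\<Sum>i<n - 1. (\<bar>w i\<bar> * exp ((real i + 2) / real n)) * (K * exp (- 2 * real s / real n))) / real n"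
      using b by (intro divide_right_mono order.trans[OF sum_abs] sum_mono) auto
    also have "\<dots> = (\<Sum>i<n - 1. \<bar>w i\<bar> * exp ((real i + 2) / real n)) / real n * (K * exp (- 2 * real s / real n))"
      by (simp add: sum_distrib_right)
    also have "\<dots> \<le> 1 * (K * exp (- 2 * real s / real n))"
      using kernel_weight_le_one[OF n_ge] K unfolding w_def by (intro mult_right_mono) auto
    finally show ?thesis by (simp add: K_def)
  qed
qed

text \<open>By \<open>after_round\<close> each deviation is \<open>1/n\<close> times a sum of fewer
  than \<open>n\<close> hits of the last round. These are at most one round older than
  \<open>t\<close>, which costs the factor \<open>exp 2\<close> between \<open>exp 5\<close> and
  \<open>exp 7\<close>.\<close>

lemma q_decay:
  assumes t: "2 * n \<le> t"
  shows "(\<Sum>y=1..n. \<bar>q t y\<bar>) \<le> 2 * exp 7 * exp (- 2 * real t / real n)"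
proof -
  define s where "s = t - n"
  have s: "t = s + n" "n \<le> s" using t by (auto simp: s_def)
  define B where "B = 2 * exp 7 / real n * exp (- 2 * real t / real n)"
  have h: "\<bar>hit (t - 1 - i)\<bar> \<le> B" if "i < n - 1" for i
  proof -
    have "\<bar>hit (t - 1 - i)\<bar> \<le> 2 * exp 5 / real n * exp (- 2 * real (t - 1 - i) / real n)"
      using that s by (intro hit_decay) auto
    also have "\<dots> \<le> 2 * exp 5 / real n * exp (2 - 2 * real t / real n)"
    proof -
      have "real t - real n \<le> real (t - 1 - i)" using that s by linarith
      then have "- 2 * real (t - 1 - i) / real n \<le> 2 - 2 * real t / real n"
        using n_pos by (simp add: field_simps)
      then show ?thesis by (intro mult_left_mono) auto
    qed
    also have "\<dots> = B"
    proof -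
      have "exp (5::real) * exp 2 = exp 7" by (simp add: exp_add[symmetric])
      then show ?thesis by (simp add: B_def exp_diff exp_minus field_simps)
    qed
    finally show ?thesis .
  qed
  have "\<bar>q t (left_hand n (Suc s + j))\<bar> \<le> B" if j: "j < n" for j
  proof -
    have "\<bar>\<Sum>i<n - 1 - j. g ^ i * hit (s + n - 1 - i)\<bar> \<le> (\<Sum>i<n - 1 - j. B)"
    proof (intro order.trans[OF sum_abs] sum_mono)
      fix i assume "i \<in> {..<n - 1 - j}"
      then have "\<bar>hit (s + n - 1 - i)\<bar> \<le> B" using h[of i] s by simp
      moreover have "g ^ i * \<bar>hit (s + n - 1 - i)\<bar> \<le> \<bar>hit (s + n - 1 - i)\<bar>"
        using g_nonneg g_le_one by (intro mult_left_le_one_le power_le_one) auto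
      ultimately show "\<bar>g ^ i * hit (s + n - 1 - i)\<bar> \<le> B"
        using g_nonneg by (simp add: abs_mult)
    qed
    also have "\<dots> \<le> B * real n"
      unfolding sum_constant card_lessThan by (subst mult.commute, intro mult_left_mono) (auto simp: B_def)
    finally have "\<bar>\<Sum>i<n - 1 - j. g ^ i * hit (s + n - 1 - i)\<bar> / real n \<le> B"
      using n_pos by (simp only: pos_divide_le_eq of_nat_0_less_iff)
    then show ?thesis using after_round[OF j, of s] s by simp
  qed
  then have "(\<Sum>j<n. \<bar>q t (left_hand n (Suc s + j))\<bar>) \<le> (\<Sum>j<n. B)"
    by (intro sum_mono) auto
  then show ?thesis
    using sum_left_hand[OF n_pos, of "\<lambda>y. \<bar>q t y\<bar>" "Suc s"] n_pos by (simp add: B_def)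
qed

text \<open>Used to bound how often the left hand meets a given card: \<open>O(1)\<close> in the
  first round and \<open>O(1/n)\<close> for each later step.\<close>

lemma hit_sum: "(\<Sum>s<t. hit s) \<le> 2 * exp 1 + 2 * exp 1 * real t / real n"
proof -
  have "(\<Sum>s<t. \<bar>hit s\<bar>) \<le> (\<Sum>s<n. \<bar>hit s\<bar>) + real t * (2 * exp 1 / real n)"
  proof (induction t)
    case 0
    then show ?case by (simp add: sum_nonneg)
  next
    case (Suc t)
    show ?case
    proof (cases "n \<le> t")
      case True
      then have "\<bar>hit t\<bar> \<le> 2 * exp 1 / real n"
        unfolding hit_def by (intro q_bounded left_hand_in n_pos)
      then show ?thesis using Suc by (simp add: algebra_simps add_divide_distrib)
    next
      case False
      then have "(\<Sum>s<Suc t. \<bar>hit s\<bar>) \<le> (\<Sum>s<n. \<bar>hit s\<bar>)"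
        by (intro sum_mono2) auto
      then show ?thesis by (simp add: add_increasing2)
    qed
  qed
  moreover have "(\<Sum>s<t. hit s) \<le> (\<Sum>s<t. \<bar>hit s\<bar>)" by (intro sum_mono) auto
  ultimately show ?thesis using hit_sum_first_round by (simp add: algebra_simps)
qed

end


section \<open>Expectations of bounded functions\<close>

lemma integrable_pmf_bounded:
  fixes F :: "'a \<Rightarrow> real"
  assumes "\<And>x. \<bar>F x\<bar> \<le> B"
  shows "integrable (measure_pmf p) F"
  using assms by (intro measure_pmf.integrable_const_bound[of _ B]) auto

lemma expectation_bind_pmf:
  fixes F :: "'a \<Rightarrow> real"
  assumes "\<And>x. \<bar>F x\<bar> \<le> B"
  shows "measure_pmf.expectation (bind_pmf p K) F
    = measure_pmf.expectation p (\<lambda>x. measure_pmf.expectation (K x) F)"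
  unfolding measure_pmf_bind
  by (rule integral_bind[where K = "count_space UNIV" and B' = 1 and B = B])
    (use assms measurable_measure_pmf[of K] in
      \<open>auto simp: measure_pmf.emeasure_space_1 measure_pmf.finite_measure_axioms measurable_def\<close>)

lemma expectation_pmf_abs_le:
  fixes F :: "'a \<Rightarrow> real"
  assumes "\<And>x. \<bar>F x\<bar> \<le> B"
  shows "\<bar>measure_pmf.expectation p F\<bar> \<le> B"
proof -
  have "\<bar>measure_pmf.expectation p F\<bar> \<le> measure_pmf.expectation p (\<lambda>x. \<bar>F x\<bar>)"
    by (rule integral_abs_bound)
  also have "\<dots> \<le> measure_pmf.expectation p (\<lambda>x. B)"
    using assms order.trans[OF abs_ge_zero assms]
    by (intro integral_mono integrable_pmf_bounded[of _ B]) auto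
  finally show ?thesis by simp
qed

subsection \<open>Comparison of laws by test functions\<close>

text \<open>For \<open>{0,1}\<close>-valued \<open>F\<close> this is total variation distance; \<open>[0,1]\<close>-valued \<open>F\<close> let the bound pass through kernels.\<close>

definition test_close :: "'a pmf \<Rightarrow> 'a pmf \<Rightarrow> real \<Rightarrow> bool" where
  "test_close p q e \<longleftrightarrow> (\<forall>F. (\<forall>x. 0 \<le> F x \<and> F x \<le> 1) \<longrightarrow>
    \<bar>measure_pmf.expectation p F - measure_pmf.expectation q F\<bar> \<le> e)"

lemma test_closeI:
  assumes "\<And>F. (\<And>x. 0 \<le> F x) \<Longrightarrow> (\<And>x. F x \<le> 1) \<Longrightarrow>
    \<bar>measure_pmf.expectation p F - measure_pmf.expectation q F\<bar> \<le> e"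
  shows "test_close p q e"
  using assms unfolding test_close_def by blast

lemma test_closeD:
  assumes "test_close p q e" "\<And>x. 0 \<le> F x" "\<And>x. F x \<le> 1"
  shows "\<bar>measure_pmf.expectation p F - measure_pmf.expectation q F\<bar> \<le> e"
  using assms unfolding test_close_def by blast

lemma test_close_refl: "test_close p p 0"
  by (simp add: test_close_def)

lemma test_close_mono: "test_close p q e \<Longrightarrow> e \<le> e' \<Longrightarrow> test_close p q e'"
  unfolding test_close_def by (meson order.trans)

lemma test_close_trans: "test_close p q e \<Longrightarrow> test_close q r e' \<Longrightarrow> test_close p r (e + e')"
  unfolding test_close_def by (smt (verit))

lemma test_close_sym: "test_close p q e \<Longrightarrow> test_close q p e"
  unfolding test_close_def by (simp add: abs_minus_commute)

lemma test_close_map: "test_close p q e \<Longrightarrow> test_close (map_pmf f p) (map_pmf f q) e"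
  unfolding test_close_def by (simp del: integral_map_pmf add: integral_map_pmf)

text \<open>The kernel is exchanged first, under \<open>p\<close>, and then \<open>p\<close> for
  \<open>q\<close>; in the second comparison the expectation of \<open>F\<close> under
  \<open>K' x\<close> is again a test function. The kernel error enters by its mean, so an error
  that is large only on a rare event stays affordable.\<close>

lemma test_close_bind:
  assumes pq: "test_close p q e"
    and K: "\<And>x. x \<in> set_pmf p \<Longrightarrow> test_close (K x) (K' x) (d x)"
    and d: "\<And>x. \<bar>d x\<bar> \<le> B"
  shows "test_close (bind_pmf p K) (bind_pmf q K') (measure_pmf.expectation p d + e)"
proof (rule test_closeI)
  fix F :: "'b \<Rightarrow> real" assume F: "\<And>x. 0 \<le> F x" "\<And>x. F x \<le> 1"
  have Fb: "\<bar>F x\<bar> \<le> 1" for x using F[of x] by simp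
  define G where "G x = measure_pmf.expectation (K x) F" for x
  define G' where "G' x = measure_pmf.expectation (K' x) F" for x
  have Gb: "\<bar>G x\<bar> \<le> 1" "\<bar>G' x\<bar> \<le> 1" "0 \<le> G' x" "G' x \<le> 1" for x
  proof -
    show "\<bar>G x\<bar> \<le> 1" "\<bar>G' x\<bar> \<le> 1" unfolding G_def G'_def by (auto intro!: expectation_pmf_abs_le Fb)
    then show "G' x \<le> 1" by simp
    show "0 \<le> G' x" unfolding G'_def using F by (intro Bochner_Integration.integral_nonneg) auto
  qed
  have int: "integrable (measure_pmf p) G" "integrable (measure_pmf p) G'" "integrable (measure_pmf p) d"
    by (rule integrable_pmf_bounded, rule Gb d)+
  have "\<bar>measure_pmf.expectation p G - measure_pmf.expectation p G'\<bar>
      = \<bar>measure_pmf.expectation p (\<lambda>x. G x - G' x)\<bar>"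
    using int by simp
  also have "\<dots> \<le> measure_pmf.expectation p (\<lambda>x. \<bar>G x - G' x\<bar>)"
    by (rule integral_abs_bound)
  also have "\<dots> \<le> measure_pmf.expectation p d"
    using int K F unfolding G_def G'_def
    by (intro integral_mono_AE) (auto simp: AE_measure_pmf_iff intro!: test_closeD integrable_abs)
  finally have "\<bar>measure_pmf.expectation p G - measure_pmf.expectation p G'\<bar> \<le> measure_pmf.expectation p d" .
  moreover have "\<bar>measure_pmf.expectation p G' - measure_pmf.expectation q G'\<bar> \<le> e"
    using Gb by (intro test_closeD[OF pq]) auto
  ultimately show "\<bar>measure_pmf.expectation (bind_pmf p K) F - measure_pmf.expectation (bind_pmf q K') F\<bar>
      \<le> measure_pmf.expectation p d + e"
    unfolding expectation_bind_pmf[of F, OF Fb] G_def[symmetric] G'_def[symmetric] by linarith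
qed

lemma test_close_bind_const:
  assumes "test_close p q e" and "\<And>x. x \<in> set_pmf p \<Longrightarrow> test_close (K x) (K' x) d"
  shows "test_close (bind_pmf p K) (bind_pmf q K') (d + e)"
  using test_close_bind[OF assms(1), of K K' "\<lambda>_. d" "\<bar>d\<bar>"] assms(2) by simp

lemma tv_dist_le:
  assumes "test_close p q e"
  shows "tv_dist p q \<le> e"
  unfolding tv_dist_def
proof (rule cSUP_least)
  fix A
  have "\<bar>measure_pmf.expectation p (indicat_real A) - measure_pmf.expectation q (indicat_real A)\<bar> \<le> e"
    by (rule test_closeD[OF assms]) (auto simp: indicator_def)
  then show "\<bar>measure_pmf.prob p A - measure_pmf.prob q A\<bar> \<le> e" by simp
qed simp

section \<open>Product laws and the cost of a shared random choice\<close>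

primrec list_prod_pmf :: "'a pmf list \<Rightarrow> 'a list pmf" where
  "list_prod_pmf [] = return_pmf []"
| "list_prod_pmf (p # ps) = bind_pmf p (\<lambda>x. map_pmf ((#) x) (list_prod_pmf ps))"

text \<open>Independent coordinates moved by independent steps remain independent; draws that do not
  depend on each other are commuted.\<close>

lemma bind_list_prod_pmf:
  "bind_pmf (list_prod_pmf ps) (\<lambda>xs. list_prod_pmf (map K xs)) = list_prod_pmf (map (\<lambda>p. bind_pmf p K) ps)"
proof (induction ps)
  case (Cons p ps)
  have "bind_pmf (list_prod_pmf (p # ps)) (\<lambda>xs. list_prod_pmf (map K xs))
    = bind_pmf p (\<lambda>x. bind_pmf (list_prod_pmf ps) (\<lambda>xs. bind_pmf (K x)
        (\<lambda>y. map_pmf ((#) y) (list_prod_pmf (map K xs)))))"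
    by (simp add: bind_assoc_pmf bind_map_pmf)
  also have "\<dots> = bind_pmf p (\<lambda>x. bind_pmf (K x) (\<lambda>y. bind_pmf (list_prod_pmf ps)
        (\<lambda>xs. map_pmf ((#) y) (list_prod_pmf (map K xs)))))"
    by (subst bind_commute_pmf) simp
  also have "\<dots> = list_prod_pmf (map (\<lambda>p. bind_pmf p K) (p # ps))"
    by (simp add: bind_assoc_pmf map_bind_pmf[symmetric] Cons.IH)
  finally show ?case .
qed (simp add: bind_return_pmf)

text \<open>The coordinates are exchanged one at a time, and their errors add up.\<close>

lemma list_prod_pmf_close:
  assumes "\<And>x. x \<in> set xs \<Longrightarrow> test_close (f x) u e"
  shows "test_close (list_prod_pmf (map f xs)) (list_prod_pmf (replicate (length xs) u)) (real (length xs) * e)"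
  using assms
proof (induction xs)
  case (Cons x xs)
  have "test_close (list_prod_pmf (map f (x # xs))) (list_prod_pmf (replicate (length (x # xs)) u))
      (real (length xs) * e + e)"
    using Cons by (auto intro!: test_close_bind_const test_close_map)
  then show ?case by (simp add: algebra_simps)
qed (simp add: test_close_refl)

text \<open>The diagonal average stands for one choice of the right hand shared by two functions of
  it, the double average for two independent choices. \<open>A\<close> and \<open>B\<close> hold the
  choices that matter to either argument, and \<open>r\<close> is a neutral choice.\<close>

lemma diagonal_average_close:
  fixes H :: "nat \<Rightarrow> nat \<Rightarrow> real"
  assumes n: "0 < n"
    and H01: "\<And>a b. 0 \<le> H a b" "\<And>a b. H a b \<le> 1"
    and AB: "A \<subseteq> {1..n}" "B \<subseteq> {1..n}"
    and HA: "\<And>a b. a \<in> {1..n} - A \<Longrightarrow> H a b = H r b"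
    and HB: "\<And>a b. b \<in> {1..n} - B \<Longrightarrow> H a b = H a r"
  shows "\<bar>(\<Sum>a=1..n. H a a) / real n - (\<Sum>a=1..n. (\<Sum>b=1..n. H a b) / real n) / real n\<bar>
    \<le> 2 * real (card (A \<inter> B)) / real n + 2 * real (card A) * real (card B) / (real n)\<^sup>2"
proof -
  text \<open>Passing from \<open>H\<close> to \<open>G\<close> leaves the difference of the two averages unchanged, but \<open>G\<close> is
    supported on \<open>A \<times> B\<close>.\<close>
  define G where "G a b = H a b - H a r - H r b + H r r" for a b
  have fin: "finite A" "finite B" using AB finite_subset by auto
  have G_abs: "\<bar>G a b\<bar> \<le> 2" for a b
    using H01[of a b] H01[of a r] H01[of r b] H01[of r r] unfolding G_def by linarith
  have G0: "G a b = 0" if "a \<in> {1..n}" "b \<in> {1..n}" "\<not> (a \<in> A \<and> b \<in> B)" for a b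
    using that HA[of a b] HA[of a r] HB[of b a] HB[of b r] unfolding G_def by auto
  have "(\<Sum>a=1..n. (\<Sum>b=1..n. G a b) / real n) / real n
      = (\<Sum>a=1..n. (\<Sum>b=1..n. H a b) / real n) / real n - (\<Sum>a=1..n. H a r) / real n
        - (\<Sum>b=1..n. H r b) / real n + H r r"
    using n by (simp add: G_def sum.distrib sum_subtractf add_divide_distrib diff_divide_distrib)
  moreover have "(\<Sum>a=1..n. G a a) / real n
      = (\<Sum>a=1..n. H a a) / real n - (\<Sum>a=1..n. H a r) / real n - (\<Sum>b=1..n. H r b) / real n + H r r"
    using n by (simp add: G_def sum.distrib sum_subtractf add_divide_distrib diff_divide_distrib)
  ultimately have "(\<Sum>a=1..n. H a a) / real n - (\<Sum>a=1..n. (\<Sum>b=1..n. H a b) / real n) / real n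
      = (\<Sum>a=1..n. G a a) / real n - (\<Sum>a=1..n. (\<Sum>b=1..n. G a b)) / (real n)\<^sup>2"
    by (simp add: sum_divide_distrib[symmetric] power2_eq_square)
  also have "\<bar>\<dots>\<bar> \<le> \<bar>\<Sum>a=1..n. G a a\<bar> / real n + \<bar>\<Sum>a=1..n. (\<Sum>b=1..n. G a b)\<bar> / (real n)\<^sup>2"
    by (rule order.trans[OF abs_triangle_ineq4]) simp
  also have "\<dots> \<le> 2 * real (card (A \<inter> B)) / real n + 2 * real (card A) * real (card B) / (real n)\<^sup>2"
  proof (intro add_mono divide_right_mono)
    show "\<bar>\<Sum>a=1..n. G a a\<bar> \<le> 2 * real (card (A \<inter> B))"
    proof -
    have "(\<Sum>a=1..n. G a a) = (\<Sum>a\<in>A \<inter> B. G a a)"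
      using AB G0 by (intro sum.mono_neutral_right) auto
    also have "\<bar>\<dots>\<bar> \<le> (\<Sum>a\<in>A \<inter> B. 2)"
      using G_abs by (intro order.trans[OF sum_abs] sum_mono)
    finally show ?thesis by simp
  qed
    show "\<bar>\<Sum>a=1..n. (\<Sum>b=1..n. G a b)\<bar> \<le> 2 * real (card A) * real (card B)"
  proof -
    have "(\<Sum>a=1..n. (\<Sum>b=1..n. G a b)) = (\<Sum>a\<in>A. (\<Sum>b=1..n. G a b))"
      using AB G0 by (intro sum.mono_neutral_right) (auto intro!: sum.neutral)
    also have "\<dots> = (\<Sum>a\<in>A. (\<Sum>b\<in>B. G a b))"
      using AB G0 by (intro sum.cong sum.mono_neutral_right) auto
    also have "\<bar>\<dots>\<bar> \<le> (\<Sum>a\<in>A. (\<Sum>b\<in>B. 2))"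
      using G_abs by (intro order.trans[OF sum_abs] sum_mono)
    finally show ?thesis by simp
  qed
  qed auto
  finally show ?thesis .
qed

subsection \<open>Several cards\<close>

definition card_step :: "nat \<Rightarrow> nat \<Rightarrow> nat \<Rightarrow> nat pmf" where
  "card_step n t x = map_pmf (\<lambda>R. Transposition.transpose (left_hand n t) R x) (pmf_of_set {1..n})"

text \<open>One draw of \<open>R\<close> moves all cards; this sharing is the only dependence
  between their motions.\<close>

definition cards_step :: "nat \<Rightarrow> nat \<Rightarrow> nat list \<Rightarrow> nat list pmf" where
  "cards_step n t xs = map_pmf (\<lambda>R. map (Transposition.transpose (left_hand n t) R) xs) (pmf_of_set {1..n})"

primrec card_chain :: "nat \<Rightarrow> nat \<Rightarrow> nat \<Rightarrow> nat pmf" where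
  "card_chain n x 0 = return_pmf x"
| "card_chain n x (Suc t) = bind_pmf (card_chain n x t) (card_step n (Suc t))"

primrec cards_chain :: "nat \<Rightarrow> nat list \<Rightarrow> nat \<Rightarrow> nat list pmf" where
  "cards_chain n xs 0 = return_pmf xs"
| "cards_chain n xs (Suc t) = bind_pmf (cards_chain n xs t) (cards_step n (Suc t))"

lemma transpose_in: "a \<in> S \<Longrightarrow> b \<in> S \<Longrightarrow> x \<in> S \<Longrightarrow> Transposition.transpose a b x \<in> S"
  by (auto simp: Transposition.transpose_def)

text \<open>The cards are split off one by one. Without contact with the left hand a split costs
  \<open>O(k / n\<^sup>2)\<close>. With contact, \<open>4 * k / n\<close> pays for splitting off the
  card under the left hand, and \<open>4 / n\<close> for each card split off before it. The bound
  \<open>k\<close> stays fixed while the list shrinks.\<close>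

lemma cards_step_close:
  assumes n: "0 < n"
  shows "distinct xs \<Longrightarrow> set xs \<subseteq> {1..n} \<Longrightarrow> length xs \<le> k \<Longrightarrow>
    test_close (cards_step n t xs) (list_prod_pmf (map (card_step n t) xs))
      (2 * real (length xs) * real k / (real n)\<^sup>2
        + (if left_hand n t \<in> set xs then (4 * real k + 4 * real (length xs)) / real n else 0))"
proof (induction xs)
  case Nil
  have "cards_step n t [] = return_pmf []" by (simp add: cards_step_def)
  then show ?case by (simp add: test_close_refl)
next
  case (Cons x xs)
  define L where "L = left_hand n t"
  define \<tau> where "\<tau> = Transposition.transpose L"
  have L: "L \<in> {1..n}" unfolding L_def by (rule left_hand_in[OF n])
  \<comment> \<open>Choices of the right hand that can move \<open>x\<close>, respectively a card of
    \<open>xs\<close>, differently from the neutral choice \<open>L\<close>, for which the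
    transposition is the identity.\<close>
  define A where "A = (if x = L then {1..n} else {x})"
  define B where "B = (if L \<in> set xs then {1..n} else set xs)"
  define M where "M = bind_pmf (card_step n t x) (\<lambda>y. map_pmf ((#) y) (cards_step n t xs))"
  define c where "c = 2 * real (card (A \<inter> B)) / real n + 2 * real (card A) * real (card B) / (real n)\<^sup>2"
  have ne: "{1..n} \<noteq> {}" "finite {1..n}" using n by auto
  have "test_close (cards_step n t (x # xs)) M c"
  proof (rule test_closeI)
    fix F :: "nat list \<Rightarrow> real" assume F: "\<And>x. 0 \<le> F x" "\<And>x. F x \<le> 1"
    have Fb: "\<bar>F x\<bar> \<le> 1" for x using F[of x] by simp
    have "measure_pmf.expectation (cards_step n t (x # xs)) F = (\<Sum>R=1..n. F (\<tau> R x # map (\<tau> R) xs)) / real n"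
      unfolding cards_step_def integral_map_pmf integral_pmf_of_set[OF ne]
      by (simp add: \<tau>_def L_def)
    moreover have "measure_pmf.expectation M F
        = (\<Sum>R=1..n. (\<Sum>R'=1..n. F (\<tau> R x # map (\<tau> R') xs)) / real n) / real n"
      unfolding M_def expectation_bind_pmf[of F, OF Fb] cards_step_def card_step_def integral_map_pmf
        integral_pmf_of_set[OF ne]
      by (simp add: \<tau>_def L_def)
    moreover have "\<bar>(\<Sum>R=1..n. F (\<tau> R x # map (\<tau> R) xs)) / real n
        - (\<Sum>R=1..n. (\<Sum>R'=1..n. F (\<tau> R x # map (\<tau> R') xs)) / real n) / real n\<bar> \<le> c"
      unfolding c_def
    proof (rule diagonal_average_close[OF n, where r = L])
      show "F (\<tau> a x # map (\<tau> b) xs) = F (\<tau> L x # map (\<tau> b) xs)" if "a \<in> {1..n} - A" for a b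
        using that by (auto simp: A_def \<tau>_def Transposition.transpose_def split: if_splits)
      show "F (\<tau> a x # map (\<tau> b) xs) = F (\<tau> a x # map (\<tau> L) xs)" if "b \<in> {1..n} - B" for a b
      proof -
        have "map (\<tau> b) xs = map (\<tau> L) xs"
          using that by (intro map_cong) (auto simp: B_def \<tau>_def Transposition.transpose_def split: if_splits)
        then show ?thesis by (simp only:)
      qed
    qed (use F Cons.prems in \<open>auto simp: A_def B_def\<close>)
    ultimately show "\<bar>measure_pmf.expectation (cards_step n t (x # xs)) F - measure_pmf.expectation M F\<bar> \<le> c"
      by simp
  qed
  moreover have "test_close M (list_prod_pmf (map (card_step n t) (x # xs)))
      ((2 * real (length xs) * real k / (real n)\<^sup>2
        + (if L \<in> set xs then (4 * real k + 4 * real (length xs)) / real n else 0)) + 0)"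
    unfolding M_def list_prod_pmf.simps list.map L_def
    using Cons.prems by (intro test_close_bind_const test_close_refl test_close_map Cons.IH) auto
  ultimately have "test_close (cards_step n t (x # xs)) (list_prod_pmf (map (card_step n t) (x # xs)))
      (c + (2 * real (length xs) * real k / (real n)\<^sup>2
        + (if L \<in> set xs then (4 * real k + 4 * real (length xs)) / real n else 0)))"
    using test_close_trans by fastforce
  moreover have "c + (2 * real (length xs) * real k / (real n)\<^sup>2
        + (if L \<in> set xs then (4 * real k + 4 * real (length xs)) / real n else 0))
      \<le> 2 * real (length (x # xs)) * real k / (real n)\<^sup>2
        + (if L \<in> set (x # xs) then (4 * real k + 4 * real (length (x # xs))) / real n else 0)"
  proof -
    have card_xs: "card (set xs) = length xs" "length xs \<le> k"
      using Cons.prems by (auto simp: distinct_card)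
    \<comment> \<open>Distinctness rules out that \<open>x\<close> and a card of \<open>xs\<close>
      are both under the left hand.\<close>
    consider "x = L" "L \<notin> set xs" | "x \<noteq> L" "L \<in> set xs" | "x \<noteq> L" "L \<notin> set xs"
      using Cons.prems by auto
    then have "c \<le> 2 * real k / (real n)\<^sup>2
        + (if x = L then (4 * real k + 4 * real (length (x # xs))) / real n else if L \<in> set xs then 4 / real n else 0)"
    proof cases
      case 1
      have "A \<inter> B = set xs" using 1 Cons.prems by (auto simp: A_def B_def)
      then have "c = 4 * real (length xs) / real n"
        using 1 n by (simp add: c_def A_def B_def card_xs power2_eq_square)
      also have "\<dots> \<le> (4 * real k + 4 * real (length (x # xs))) / real n" using card_xs by (intro divide_right_mono) auto
      finally show ?thesis using 1 by (simp add: add_increasing)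
    next
      case 2
      have "A \<inter> B = {x}" using 2 Cons.prems by (auto simp: A_def B_def)
      then have "c = 4 / real n"
        using 2 n by (simp add: c_def A_def B_def power2_eq_square)
      then show ?thesis using 2 by simp
    next
      case 3
      have "A \<inter> B = {}" using 3 Cons.prems by (auto simp: A_def B_def)
      then have "c = 2 * real (length xs) / (real n)\<^sup>2"
        using 3 by (simp add: c_def A_def B_def card_xs)
      also have "\<dots> \<le> 2 * real k / (real n)\<^sup>2" using card_xs by (intro divide_right_mono) auto
      finally show ?thesis using 3 by simp
    qed
    moreover have "x = L \<Longrightarrow> L \<notin> set xs" using Cons.prems by auto
    ultimately show ?thesis
      by (auto simp: add_divide_distrib distrib_left distrib_right split: if_splits)
  qed
  ultimately show ?case unfolding L_def by (rule test_close_mono)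
qed


section \<open>Supports and marginals of the location chains\<close>

lemma set_cards_step:
  assumes "0 < n" "distinct xs" "set xs \<subseteq> {1..n}" "ys \<in> set_pmf (cards_step n t xs)"
  shows "distinct ys \<and> set ys \<subseteq> {1..n} \<and> length ys = length xs"
proof -
  obtain R where R: "R \<in> {1..n}" "ys = map (Transposition.transpose (left_hand n t) R) xs"
    using assms(1,4) by (auto simp: cards_step_def)
  have "inj_on (Transposition.transpose (left_hand n t) R) (set xs)"
    by (rule inj_on_subset[OF inj_transpose]) simp
  moreover have "Transposition.transpose (left_hand n t) R x \<in> {1..n}" if "x \<in> set xs" for x
    using assms(3) that by (intro transpose_in left_hand_in[OF assms(1)] R(1)) auto
  ultimately show ?thesis
    using assms(2) unfolding R(2) distinct_map set_map length_map
    by (intro conjI image_subsetI) simp_all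
qed

lemma set_cards_chain:
  assumes "0 < n" "distinct xs" "set xs \<subseteq> {1..n}"
  shows "ys \<in> set_pmf (cards_chain n xs t) \<Longrightarrow> distinct ys \<and> set ys \<subseteq> {1..n} \<and> length ys = length xs"
proof (induction t arbitrary: ys)
  case (Suc t)
  then obtain zs where zs: "zs \<in> set_pmf (cards_chain n xs t)" "ys \<in> set_pmf (cards_step n (Suc t) zs)"
    by auto
  show ?case using Suc.IH[OF zs(1)] set_cards_step[OF assms(1) _ _ zs(2)] by simp
qed (use assms in simp)

lemma set_card_chain:
  assumes "0 < n" "x \<in> {1..n}"
  shows "set_pmf (card_chain n x t) \<subseteq> {1..n}"
proof (induction t)
  case (Suc t)
  have "set_pmf (card_step n (Suc t) y) \<subseteq> {1..n}" if "y \<in> {1..n}" for y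
  proof
    fix z assume "z \<in> set_pmf (card_step n (Suc t) y)"
    then obtain R where "R \<in> {1..n}" "z = Transposition.transpose (left_hand n (Suc t)) R y"
      using assms(1) by (auto simp: card_step_def)
    then show "z \<in> {1..n}"
      using transpose_in[OF left_hand_in[OF assms(1)] _ that] by blast
  qed
  then show ?case using Suc unfolding card_chain.simps set_bind_pmf by blast
qed (use assms in simp)

text \<open>A single coordinate cannot see that \<open>R\<close> is shared. Single-card estimates
  therefore apply to the joint chain.\<close>

lemma cards_chain_nth:
  assumes "0 < n" "distinct xs" "set xs \<subseteq> {1..n}" "i < length xs"
  shows "map_pmf (\<lambda>ys. ys ! i) (cards_chain n xs t) = card_chain n (xs ! i) t"
proof (induction t)
  case (Suc t)
  have "map_pmf (\<lambda>ys. ys ! i) (cards_chain n xs (Suc t))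
      = bind_pmf (cards_chain n xs t) (\<lambda>ys. map_pmf (\<lambda>ys. ys ! i) (cards_step n (Suc t) ys))"
    by (simp add: map_bind_pmf)
  also have "\<dots> = bind_pmf (cards_chain n xs t) (\<lambda>ys. card_step n (Suc t) (ys ! i))"
    using set_cards_chain[OF assms(1-3)] assms(4)
    by (intro bind_pmf_cong) (auto simp: cards_step_def card_step_def map_pmf_comp)
  also have "\<dots> = card_chain n (xs ! i) (Suc t)"
    by (simp add: Suc[symmetric] bind_map_pmf)
  finally show ?case .
qed simp

lemma prob_mem_cards_chain_le:
  assumes "0 < n" "distinct xs" "set xs \<subseteq> {1..n}"
  shows "measure_pmf.prob (cards_chain n xs t) {ys. a \<in> set ys} \<le> (\<Sum>i<length xs. pmf (card_chain n (xs ! i) t) a)"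
proof -
  have "measure_pmf.prob (cards_chain n xs t) {ys. a \<in> set ys}
      \<le> measure_pmf.prob (cards_chain n xs t) (\<Union>i<length xs. {ys. ys ! i = a})"
    using set_cards_chain[OF assms]
    by (intro measure_pmf.finite_measure_mono_AE) (auto simp: AE_measure_pmf_iff in_set_conv_nth)
  also have "\<dots> \<le> (\<Sum>i<length xs. measure_pmf.prob (cards_chain n xs t) {ys. ys ! i = a})"
    by (rule measure_pmf.finite_measure_subadditive_finite) auto
  also have "\<dots> = (\<Sum>i<length xs. pmf (card_chain n (xs ! i) t) a)"
    by (intro sum.cong) (auto simp: cards_chain_nth[OF assms, symmetric] pmf_map vimage_def)
  finally show ?thesis .
qed

section \<open>From decks to locations\<close>

lemma shuffle_permutes:
  assumes "0 < n" "\<sigma>\<^sub>0 permutes {1..n}"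
  shows "\<sigma> \<in> set_pmf (shuffle n \<sigma>\<^sub>0 t) \<Longrightarrow> \<sigma> permutes {1..n}"
proof (induction t arbitrary: \<sigma>)
  case (Suc t)
  then show ?case
    using assms(1) left_hand_in[OF assms(1), of "Suc t"]
    by (auto intro!: permutes_compose permutes_swap_id)
qed (use assms in simp)

text \<open>A transposition is its own inverse, so the inverse of
  \<open>\<sigma> \<circ> \<tau>\<close> is \<open>\<tau> \<circ> inv \<sigma>\<close>: the tracked
  locations form a Markov chain of their own, whatever the other cards do.\<close>

lemma card_locations_shuffle:
  assumes "0 < n" "\<sigma>\<^sub>0 permutes {1..n}"
  shows "card_locations cs (shuffle n \<sigma>\<^sub>0 t) = cards_chain n (map (inv \<sigma>\<^sub>0) cs) t"
proof (induction t)
  case (Suc t)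
  have "card_locations cs (shuffle n \<sigma>\<^sub>0 (Suc t))
      = bind_pmf (shuffle n \<sigma>\<^sub>0 t) (\<lambda>\<sigma>. cards_step n (Suc t) (map (inv \<sigma>) cs))"
    unfolding card_locations_def shuffle.simps map_bind_pmf
  proof (intro bind_pmf_cong refl)
    fix \<sigma> assume "\<sigma> \<in> set_pmf (shuffle n \<sigma>\<^sub>0 t)"
    then have "bij \<sigma>" using shuffle_permutes[OF assms] permutes_bij by blast
    then show "map_pmf (\<lambda>\<sigma>. map (inv \<sigma>) cs)
        (map_pmf (\<lambda>R. \<sigma> \<circ> Transposition.transpose (left_hand n (Suc t)) R) (pmf_of_set {1..n}))
      = cards_step n (Suc t) (map (inv \<sigma>) cs)"
      by (simp add: cards_step_def map_pmf_comp o_inv_distrib)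
  qed
  also have "\<dots> = bind_pmf (card_locations cs (shuffle n \<sigma>\<^sub>0 t)) (cards_step n (Suc t))"
    by (simp add: card_locations_def bind_map_pmf)
  finally show ?case by (simp add: Suc)
qed (simp add: card_locations_def)

text \<open>For each fixed \<open>R\<close>, composing with the transposition is an involution on
  the permutations, hence keeps the uniform law; averaging over \<open>R\<close> preserves
  this.\<close>

lemma uniform_deck_stationary:
  assumes "0 < n"
  shows "bind_pmf (uniform_deck n) (\<lambda>\<sigma>. shuffle n \<sigma> t) = uniform_deck n"
proof (induction t)
  case 0
  then show ?case by (simp add: bind_return_pmf')
next
  case (Suc t)
  define S where "S = {\<sigma>. \<sigma> permutes {1..n}}"
  define \<tau> where "\<tau> = Transposition.transpose (left_hand n (Suc t))"
  have S: "S \<noteq> {}" "finite S"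
    unfolding S_def using permutes_id by (blast, simp add: finite_permutations)
  have "map_pmf (\<lambda>\<sigma>. \<sigma> \<circ> \<tau> R) (uniform_deck n) = uniform_deck n" if "R \<in> {1..n}" for R
  proof -
    have R: "\<tau> R permutes {1..n}"
      unfolding \<tau>_def using that left_hand_in[OF assms] by (intro permutes_swap_id) auto
    have "\<tau> R \<circ> \<tau> R = id" by (simp add: \<tau>_def)
    then have "bij_betw (\<lambda>\<sigma>. \<sigma> \<circ> \<tau> R) S S"
      using R by (intro bij_betwI[where g = "\<lambda>\<sigma>. \<sigma> \<circ> \<tau> R"])
        (auto simp: S_def permutes_compose comp_assoc)
    then show ?thesis
      unfolding uniform_deck_def S_def[symmetric] using S by (intro map_pmf_of_set_bij_betw)
  qed
  then have "bind_pmf (pmf_of_set {1..n}) (\<lambda>R. map_pmf (\<lambda>\<sigma>. \<sigma> \<circ> \<tau> R) (uniform_deck n)) = uniform_deck n"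
    using assms by (subst bind_pmf_cong[OF refl, where g = "\<lambda>_. uniform_deck n"]) auto
  moreover have "bind_pmf (uniform_deck n) (\<lambda>\<sigma>. shuffle n \<sigma> (Suc t))
      = bind_pmf (uniform_deck n) (\<lambda>\<sigma>. map_pmf (\<lambda>R. \<sigma> \<circ> \<tau> R) (pmf_of_set {1..n}))"
    unfolding shuffle.simps \<tau>_def by (simp add: bind_assoc_pmf[symmetric] Suc)
  ultimately show ?case
    unfolding map_pmf_def by (subst (asm) (2) bind_commute_pmf) simp
qed

section \<open>The single-card chain as a sweep recurrence\<close>

lemma pmf_card_step:
  assumes "z \<in> {1..n}" "y \<in> {1..n}"
  shows "pmf (card_step n t z) y = (if z = left_hand n t \<or> y = left_hand n t then 1 / real n
    else if y = z then 1 - 1 / real n else 0)"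
proof -
  define L where "L = left_hand n t"
  have L: "L \<in> {1..n}" unfolding L_def using assms by (intro left_hand_in) auto
  have "pmf (card_step n t z) y = real (card {R \<in> {1..n}. Transposition.transpose L R z = y}) / real n"
  proof -
    have "{1..n} \<inter> (\<lambda>R. Transposition.transpose L R z) -` {y} = {R \<in> {1..n}. Transposition.transpose L R z = y}"
      by auto
    then show ?thesis
      using assms by (simp add: card_step_def L_def pmf_map measure_pmf_of_set)
  qed
  moreover have "{R \<in> {1..n}. Transposition.transpose L R z = y}
      = (if z = L then {y} else if y = L then {z} else if y = z then {1..n} - {z} else {})"
    using assms L by (auto simp: Transposition.transpose_def)
  ultimately show ?thesis
    using assms by (auto simp: L_def[symmetric] field_simps of_nat_diff)
qed

text \<open>The left hand's location is reached with probability \<open>1/n\<close> from everywhere;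
  any other \<open>y\<close> is reached only from itself and from the left hand's location.
  Subtracting \<open>1/n\<close> makes this the recurrence of the locale.\<close>

lemma card_chain_sweep_recurrence:
  assumes n: "100 \<le> n" and x: "x \<in> {1..n}"
  shows "sweep_recurrence n (\<lambda>t y. pmf (card_chain n x t) y - 1 / real n)"
proof
  have n0: "0 < n" using n by simp
  have total: "(\<Sum>y=1..n. pmf (card_chain n x t) y) = 1" for t
    by (rule sum_pmf_eq_1[OF _ set_card_chain[OF n0 x]]) simp
  show "(\<Sum>y=1..n. pmf (card_chain n x t) y - 1 / real n) = 0" for t
    using total[of t] n0 by (simp add: sum_subtractf)
  show "(\<Sum>y=1..n. \<bar>pmf (card_chain n x 0) y - 1 / real n\<bar>) \<le> 2"
  proof -
    have "(\<Sum>y=1..n. \<bar>pmf (card_chain n x 0) y - 1 / real n\<bar>) \<le> (\<Sum>y=1..n. pmf (card_chain n x 0) y + 1 / real n)"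
      by (intro sum_mono order.trans[OF abs_triangle_ineq4]) simp
    then show ?thesis using total[of 0] n0 by (simp only: sum.distrib) simp
  qed
  fix t y assume y: "y \<in> {1..n}"
  define L where "L = left_hand n (Suc t)"
  have L: "L \<in> {1..n}" unfolding L_def by (rule left_hand_in[OF n0])
  define p where "p = pmf (card_chain n x t)"
  have "pmf (card_chain n x (Suc t)) y = (\<Sum>z=1..n. p z * pmf (card_step n (Suc t) z) y)"
    unfolding card_chain.simps pmf_bind p_def
    by (subst integral_measure_pmf[of "{1..n}"]) (use set_card_chain[OF n0 x, of t] in auto)
  also have "\<dots> = (if y = L then 1 / real n else (1 - 1 / real n) * p y + p L / real n)"
  proof (cases "y = L")
    case True
    then have "(\<Sum>z=1..n. p z * pmf (card_step n (Suc t) z) y) = (\<Sum>z=1..n. p z) / real n"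
      unfolding sum_divide_distrib using y by (intro sum.cong) (auto simp: pmf_card_step L_def)
    then show ?thesis using True total[of t] by (simp add: p_def)
  next
    case False
    have "(\<Sum>z=1..n. p z * pmf (card_step n (Suc t) z) y) = (\<Sum>z\<in>{y, L}. p z * pmf (card_step n (Suc t) z) y)"
      using False y L by (intro sum.mono_neutral_right) (auto simp: pmf_card_step L_def[symmetric])
    then show ?thesis using False y L by (simp add: pmf_card_step L_def[symmetric] mult.commute)
  qed
  finally show "pmf (card_chain n x (Suc t)) y - 1 / real n =
     (if y = left_hand n (Suc t) then 0
      else (1 - 1 / real n) * (pmf (card_chain n x t) y - 1 / real n)
        + (pmf (card_chain n x t) (left_hand n (Suc t)) - 1 / real n) / real n)"
    unfolding L_def[symmetric] p_def[symmetric] by (simp add: algebra_simps diff_divide_distrib)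
qed fact

lemma card_chain_close:
  assumes "100 \<le> n" "x \<in> {1..n}" "2 * n \<le> t"
  shows "test_close (card_chain n x t) (pmf_of_set {1..n}) (2 * exp 7 * exp (- 2 * real t / real n))"
proof (rule test_closeI)
  fix F :: "nat \<Rightarrow> real" assume F: "\<And>x. 0 \<le> F x" "\<And>x. F x \<le> 1"
  have n0: "0 < n" using assms by simp
  have "measure_pmf.expectation (card_chain n x t) F = (\<Sum>y=1..n. pmf (card_chain n x t) y * F y)"
    using set_card_chain[OF n0 assms(2), of t] by (subst integral_measure_pmf[of "{1..n}"]) auto
  moreover have "measure_pmf.expectation (pmf_of_set {1..n}) F = (\<Sum>y=1..n. (1 / real n) * F y)"
    using n0 by (subst integral_pmf_of_set) (auto simp: sum_divide_distrib)
  ultimately have "measure_pmf.expectation (card_chain n x t) F - measure_pmf.expectation (pmf_of_set {1..n}) F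
      = (\<Sum>y=1..n. (pmf (card_chain n x t) y - 1 / real n) * F y)"
    by (simp add: sum_subtractf left_diff_distrib)
  also have "\<bar>\<dots>\<bar> \<le> (\<Sum>y=1..n. \<bar>pmf (card_chain n x t) y - 1 / real n\<bar>)"
  proof (intro order.trans[OF sum_abs] sum_mono)
    fix y
    show "\<bar>(pmf (card_chain n x t) y - 1 / real n) * F y\<bar> \<le> \<bar>pmf (card_chain n x t) y - 1 / real n\<bar>"
      unfolding abs_mult using F[of y] by (intro mult_right_le_one_le) auto
  qed
  also have "\<dots> \<le> 2 * exp 7 * exp (- 2 * real t / real n)"
    by (rule sweep_recurrence.q_decay[OF card_chain_sweep_recurrence[OF assms(1,2)] assms(3)])
  finally show "\<bar>measure_pmf.expectation (card_chain n x t) F - measure_pmf.expectation (pmf_of_set {1..n}) F\<bar>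
      \<le> 2 * exp 7 * exp (- 2 * real t / real n)" .
qed

text \<open>The sum is the expected number of steps at which the left hand finds the card. The
  constants come from \<open>2 * exp 1 \<le> 6\<close> and the stationary rate
  \<open>1/n\<close>.\<close>

lemma card_chain_hits:
  assumes n: "100 \<le> n" and x: "x \<in> {1..n}"
  shows "(\<Sum>s<t. pmf (card_chain n x s) (left_hand n (Suc s))) \<le> 6 + 7 * real t / real n"
proof -
  interpret sweep_recurrence n "\<lambda>t y. pmf (card_chain n x t) y - 1 / real n"
    by (rule card_chain_sweep_recurrence[OF assms])
  have "(\<Sum>s<t. pmf (card_chain n x s) (left_hand n (Suc s))) = (\<Sum>s<t. hit s) + real t / real n"
    by (simp add: hit_def sum_subtractf)
  also have "\<dots> \<le> 2 * exp 1 + 2 * exp 1 * real t / real n + real t / real n"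
    using hit_sum[of t] by simp
  also have "\<dots> \<le> 2 * 3 + 2 * 3 * real t / real n + real t / real n"
    using exp_le by (intro add_mono divide_right_mono mult_right_mono mult_left_mono) auto
  finally show ?thesis by (simp add: add_divide_distrib[symmetric])
qed

section \<open>Joint law against product law\<close>

text \<open>Step by step the shared choice is replaced by independent ones. A step costs
  \<open>2 * k\<^sup>2 / n\<^sup>2\<close>, plus \<open>8 * k / n\<close> times the probability that
  the left hand is on a tracked card. Summing with \<open>card_chain_hits\<close> gives
  \<open>48 = 8 * 6\<close> and \<open>58 = 2 + 8 * 7\<close>.\<close>

lemma cards_chain_close_product:
  assumes n: "100 \<le> n" and xs: "distinct xs" "set xs \<subseteq> {1..n}" "length xs = k"
  shows "test_close (cards_chain n xs t) (list_prod_pmf (map (\<lambda>x. card_chain n x t) xs))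
    ((real k)\<^sup>2 / real n * (48 + 58 * real t / real n))"
proof -
  have n0: "0 < n" using n by simp
  define h where "h s = (\<Sum>i<k. pmf (card_chain n (xs ! i) s) (left_hand n (Suc s)))" for s
  have "test_close (cards_chain n xs t) (list_prod_pmf (map (\<lambda>x. card_chain n x t) xs))
      (\<Sum>s<t. 2 * real k * real k / (real n)\<^sup>2 + 8 * real k / real n * h s)"
  proof (induction t)
    case 0
    have "list_prod_pmf (map return_pmf ys) = return_pmf ys" for ys :: "nat list"
      by (induction ys) (auto simp: bind_return_pmf)
    then show ?case by (simp add: test_close_refl)
  next
    case (Suc t)
    define L where "L = left_hand n (Suc t)"
    define d where "d ys = 2 * real k * real k / (real n)\<^sup>2 + 8 * real k / real n * indicat_real {ys. L \<in> set ys} ys"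
      for ys
    have "test_close (cards_step n (Suc t) ys) (list_prod_pmf (map (card_step n (Suc t)) ys)) (d ys)"
      if "ys \<in> set_pmf (cards_chain n xs t)" for ys
    proof -
      have ys: "distinct ys" "set ys \<subseteq> {1..n}" "length ys = k"
        using set_cards_chain[OF n0 xs(1,2) that] xs(3) by auto
      show ?thesis
        using cards_step_close[OF n0 ys(1,2), of k "Suc t"] ys(3)
        by (auto simp: d_def L_def indicator_def)
    qed
    moreover have "\<bar>d ys\<bar> \<le> 2 * real k * real k / (real n)\<^sup>2 + 8 * real k / real n" for ys
      by (auto simp: d_def indicator_def)
    ultimately have "test_close (cards_chain n xs (Suc t))
        (bind_pmf (list_prod_pmf (map (\<lambda>x. card_chain n x t) xs)) (\<lambda>ys. list_prod_pmf (map (card_step n (Suc t)) ys)))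
        (measure_pmf.expectation (cards_chain n xs t) d
          + (\<Sum>s<t. 2 * real k * real k / (real n)\<^sup>2 + 8 * real k / real n * h s))"
      unfolding cards_chain.simps by (rule test_close_bind[OF Suc])
    moreover have "measure_pmf.expectation (cards_chain n xs t) d
        \<le> 2 * real k * real k / (real n)\<^sup>2 + 8 * real k / real n * h t"
    proof -
      have "integrable (measure_pmf (cards_chain n xs t))
          (\<lambda>ys. 8 * real k / real n * indicat_real {ys. L \<in> set ys} ys)"
        by (rule integrable_pmf_bounded[of _ "8 * real k / real n"]) (auto simp: indicator_def)
      then have "measure_pmf.expectation (cards_chain n xs t) d = 2 * real k * real k / (real n)\<^sup>2
          + 8 * real k / real n * measure_pmf.prob (cards_chain n xs t) {ys. L \<in> set ys}"
        unfolding d_def by (subst Bochner_Integration.integral_add) simp_all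
      also have "\<dots> \<le> 2 * real k * real k / (real n)\<^sup>2 + 8 * real k / real n * h t"
        using prob_mem_cards_chain_le[OF n0 xs(1,2), of t L] xs(3)
        by (intro add_left_mono mult_left_mono) (auto simp: h_def L_def)
      finally show ?thesis .
    qed
    ultimately show ?case
      by (auto simp: bind_list_prod_pmf comp_def elim!: test_close_mono)
  qed
  moreover have "(\<Sum>s<t. 2 * real k * real k / (real n)\<^sup>2 + 8 * real k / real n * h s)
      \<le> (real k)\<^sup>2 / real n * (48 + 58 * real t / real n)"
  proof -
    have "(\<Sum>s<t. h s) = (\<Sum>i<k. \<Sum>s<t. pmf (card_chain n (xs ! i) s) (left_hand n (Suc s)))"
      unfolding h_def by (rule sum.swap)
    also have "\<dots> \<le> (\<Sum>i<k. 6 + 7 * real t / real n)"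
      using xs by (intro sum_mono card_chain_hits n) (auto simp: subset_iff)
    finally have "(\<Sum>s<t. h s) \<le> real k * (6 + 7 * real t / real n)" by simp
    then have "8 * real k / real n * (\<Sum>s<t. h s) \<le> 8 * real k / real n * (real k * (6 + 7 * real t / real n))"
      by (intro mult_left_mono) auto
    moreover have "2 * real k * real k / (real n)\<^sup>2 * real t + 8 * real k / real n * (real k * (6 + 7 * real t / real n))
        = (real k)\<^sup>2 / real n * (48 + 58 * real t / real n)"
      using n0 by (simp add: power2_eq_square field_simps)
    moreover have "(\<Sum>s<t. 2 * real k * real k / (real n)\<^sup>2 + 8 * real k / real n * h s)
        = 2 * real k * real k / (real n)\<^sup>2 * real t + 8 * real k / real n * (\<Sum>s<t. h s)"
      unfolding sum.distrib sum_distrib_left by simp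
    ultimately show ?thesis by linarith
  qed
  ultimately show ?thesis by (rule test_close_mono)
qed

lemma cards_chain_close_uniform:
  assumes n: "100 \<le> n" and xs: "distinct xs" "set xs \<subseteq> {1..n}" "length xs = k" and t: "2 * n \<le> t"
  shows "test_close (cards_chain n xs t) (list_prod_pmf (replicate k (pmf_of_set {1..n})))
    ((real k)\<^sup>2 / real n * (48 + 58 * real t / real n) + real k * (2 * exp 7 * exp (- 2 * real t / real n)))"
proof -
  have "test_close (list_prod_pmf (map (\<lambda>x. card_chain n x t) xs))
     (list_prod_pmf (replicate (length xs) (pmf_of_set {1..n})))
     (real (length xs) * (2 * exp 7 * exp (- 2 * real t / real n)))"
    using xs by (intro list_prod_pmf_close card_chain_close n t) auto
  then show ?thesis
    using test_close_trans[OF cards_chain_close_product[OF n xs]] xs(3) by simp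
qed

text \<open>The factor 2 arises because the shuffled deck and the uniform deck are each compared
  with the product law \<open>U\<close>; by stationarity the latter is a mixture of shuffled
  decks.\<close>

lemma tv_dist_card_locations_le:
  assumes n: "100 \<le> n" and cs: "distinct cs" "set cs \<subseteq> {1..n}" "length cs = k" and t: "2 * n \<le> t"
    and \<sigma>\<^sub>0: "\<sigma>\<^sub>0 permutes {1..n}"
  shows "tv_dist (card_locations cs (shuffle n \<sigma>\<^sub>0 t)) (card_locations cs (uniform_deck n))
    \<le> 2 * ((real k)\<^sup>2 / real n * (48 + 58 * real t / real n) + real k * (2 * exp 7 * exp (- 2 * real t / real n)))"
proof -
  define e where "e = (real k)\<^sup>2 / real n * (48 + 58 * real t / real n) + real k * (2 * exp 7 * exp (- 2 * real t / real n))"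
  define U where "U = list_prod_pmf (replicate k (pmf_of_set {1..n}))"
  have n0: "0 < n" using n by simp
  have close: "test_close (card_locations cs (shuffle n \<sigma> t)) U e" if "\<sigma> permutes {1..n}" for \<sigma>
    unfolding card_locations_shuffle[OF n0 that] e_def U_def
    using cs permutes_in_image[OF permutes_inv[OF that]] permutes_inj[OF permutes_inv[OF that]]
    by (intro cards_chain_close_uniform n t) (auto simp: distinct_map intro: inj_on_subset)
  have "card_locations cs (uniform_deck n) = bind_pmf (uniform_deck n) (\<lambda>\<sigma>. card_locations cs (shuffle n \<sigma> t))"
    using arg_cong[OF uniform_deck_stationary[OF n0, of t], of "card_locations cs"]
    by (simp add: card_locations_def map_bind_pmf)
  moreover have "test_close (bind_pmf (uniform_deck n) (\<lambda>\<sigma>. card_locations cs (shuffle n \<sigma> t)))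
      (bind_pmf (uniform_deck n) (\<lambda>_. U)) (e + 0)"
  proof (intro test_close_bind_const test_close_refl close)
    fix \<sigma> assume "\<sigma> \<in> set_pmf (uniform_deck n)"
    moreover have "set_pmf (uniform_deck n) = {\<sigma>. \<sigma> permutes {1..n}}"
      unfolding uniform_deck_def using permutes_id by (intro set_pmf_of_set) (blast, simp add: finite_permutations)
    ultimately show "\<sigma> permutes {1..n}" by simp
  qed
  ultimately have "test_close (card_locations cs (uniform_deck n)) U e" by simp
  from tv_dist_le[OF test_close_trans[OF close[OF \<sigma>\<^sub>0] test_close_sym[OF this]]]
  show ?thesis by (simp only: e_def mult_2)
qed

section \<open>The mixing time and the choice of constants\<close>

lemma partial_mixing_time_le:
  assumes n: "100 \<le> n" and k: "k \<le> n" and t: "2 * n \<le> t"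
    and e: "2 * ((real k)\<^sup>2 / real n * (48 + 58 * real t / real n)
      + real k * (2 * exp 7 * exp (- 2 * real t / real n))) < \<epsilon>"
  shows "partial_mixing_time n k \<epsilon> \<le> enat t"
proof -
  define C where "C = {cs. distinct cs \<and> set cs \<in> Omega n k}"
  have C: "distinct cs \<and> set cs \<subseteq> {1..n} \<and> length cs = k" if "cs \<in> C" for cs
    using that by (auto simp: C_def Omega_def distinct_card)
  have "C \<subseteq> {cs. length cs = k \<and> distinct cs \<and> set cs \<subseteq> {1..n}}" using C by auto
  then have "finite C" by (rule finite_subset) (rule finite_subset[OF _ finite_lists_length_eq[of "{1..n}" k]], auto)
  \<comment> \<open>A witness that the maximum ranges over a nonempty set; here
    \<open>k \<le> n\<close> enters.\<close>
  moreover have "[1..<Suc k] \<in> C" using k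
    by (auto simp: C_def Omega_def atLeastLessThanSuc_atLeastAtMost simp del: upt_Suc)
  moreover have "worst_dist n cs t < \<epsilon>" if "cs \<in> C" for cs
    unfolding worst_dist_def
  proof (subst Max_less_iff)
    show "finite ((\<lambda>\<sigma>\<^sub>0. tv_dist (card_locations cs (shuffle n \<sigma>\<^sub>0 t)) (card_locations cs (uniform_deck n)))
       ` {\<sigma>\<^sub>0. \<sigma>\<^sub>0 permutes {1..n}})"
      by (simp add: finite_permutations)
    show "(\<lambda>\<sigma>\<^sub>0. tv_dist (card_locations cs (shuffle n \<sigma>\<^sub>0 t)) (card_locations cs (uniform_deck n)))
       ` {\<sigma>\<^sub>0. \<sigma>\<^sub>0 permutes {1..n}} \<noteq> {}"
      using permutes_id by blast
    show "\<forall>d\<in>(\<lambda>\<sigma>\<^sub>0. tv_dist (card_locations cs (shuffle n \<sigma>\<^sub>0 t)) (card_locations cs (uniform_deck n)))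
       ` {\<sigma>\<^sub>0. \<sigma>\<^sub>0 permutes {1..n}}. d < \<epsilon>"
      using C[OF that] e by (auto intro!: order.strict_trans1[OF tv_dist_card_locations_le[OF n _ _ _ t]])
  qed
  ultimately have "Max ((\<lambda>cs. worst_dist n cs t) ` C) < \<epsilon>"
    by (subst Max_less_iff) auto
  then show ?thesis
    unfolding partial_mixing_time_def C_def by (intro Inf_lower) auto
qed

lemma two_power_le_exp: "2 ^ m \<le> exp (real m)"
proof -
  have "(2::real) ^ m \<le> exp 1 ^ m" using exp_ge_add_one_self[of 1] by (intro power_mono) auto
  then show ?thesis by (simp add: exp_of_nat_mult[symmetric])
qed

theorem theorem2:
  fixes k :: "nat \<Rightarrow> nat"
  assumes "\<And>n. n \<ge> 1 \<Longrightarrow> k n \<in> {1..n}"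
    and "(\<lambda>n. real (k n)) \<in> o(\<lambda>n. (real n / ln (real n)) powr (1 / 2))"
  shows "\<exists>C>0. \<forall>\<^sub>F n in sequentially.
    ereal_of_enat (partial_mixing_time n (k n) (1 / 4))
      \<le> ereal (0.5006 * real n * (ln (real (k n)) + C))"
proof (intro exI conjI)
  \<comment> \<open>With \<open>C = 13\<close> the decay term is at most
    \<open>2 * exp (- 6)\<close>, and \<open>0.5006 * 13 > 2\<close> leaves room for the two initial
    rounds.\<close>
  show "(13::real) > 0" by simp
  \<comment> \<open>The constant \<open>1/200\<close> brings the collision term down to
    \<open>860 / 40000\<close>; then \<open>2 * (860 / 40000 + 2 / 64) < 1/4\<close>.\<close>
  have "\<forall>\<^sub>F n in sequentially. norm (real (k n)) \<le> 1 / 200 * norm ((real n / ln (real n)) powr (1 / 2))"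
    by (rule landau_o.smallD[OF assms(2)]) simp
  then show "\<forall>\<^sub>F n in sequentially. ereal_of_enat (partial_mixing_time n (k n) (1 / 4))
      \<le> ereal (0.5006 * real n * (ln (real (k n)) + 13))"
    using eventually_ge_at_top[of 1000]
  proof eventually_elim
    case (elim n)
    define K where "K = real (k n)"
    define N where "N = real n"
    define l where "l = ln N"
    have N: "1000 \<le> N" using elim by (simp add: N_def)
    have K: "1 \<le> K" "K \<le> N" "k n \<le> n" using assms(1)[of n] elim by (auto simp: K_def N_def)
    have l: "1 \<le> l"
      using N exp_le unfolding l_def by (subst ln_ge_iff) auto
    have lK: "0 \<le> ln K" "ln K \<le> l" using K by (auto simp: l_def)
    have K2: "K\<^sup>2 / N \<le> 1 / 40000 / l"
    proof -
      have "K \<le> 1 / 200 * (N / l) powr (1 / 2)" using elim(1) by (simp add: K_def N_def l_def)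
      then have "K\<^sup>2 \<le> (1 / 200 * (N / l) powr (1 / 2))\<^sup>2" using K by (intro power_mono) auto
      also have "\<dots> = 1 / 40000 * (N / l)"
        using N l by (simp add: power_mult_distrib powr_half_sqrt power2_eq_square)
      finally show ?thesis using N l by (simp add: field_simps)
    qed
    define X where "X = 2503 / 5000 * N * (ln K + 13)"
    define T where "T = nat \<lfloor>X\<rfloor>"
    have X: "0 \<le> X" using N lK by (simp add: X_def)
    have T: "real T \<le> X" "X - 1 < real T" using X by (auto simp: T_def)
    have "2 * N \<le> real T"
    proof -
      have "2503 / 5000 * N * 13 \<le> X" unfolding X_def using N lK by (intro mult_left_mono) auto
      then show ?thesis using T N by linarith
    qed
    then have T2: "2 * n \<le> T" unfolding N_def by linarith
    have TN: "real T / N \<le> l + 13"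
    proof -
      have "real T / N \<le> X / N" using T N by (intro divide_right_mono) auto
      also have "X / N = 2503 / 5000 * (ln K + 13)" using N by (simp add: X_def)
      also have "\<dots> \<le> 1 * (l + 13)" using lK by (intro mult_mono) auto
      finally show ?thesis by simp
    qed
    have "K\<^sup>2 / N * (48 + 58 * real T / N) \<le> 1 / 40000 / l * (48 + 58 * (l + 13))"
      using K2 TN l N by (intro mult_mono) auto
    also have "\<dots> \<le> 1 / 40000 / l * (860 * l)"
      using l by (intro mult_left_mono) auto
    also have "\<dots> = 860 / 40000" using l by simp
    finally have collisions: "K\<^sup>2 / N * (48 + 58 * real T / N) \<le> 860 / 40000" .
    \<comment> \<open>Here the excess of 0.5006 over \<open>1/2\<close> pays for the rounding of
      \<open>X\<close> to \<open>T\<close>: \<open>2 * X - Y = 0.0012 * Y\<close>, which exceeds 2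
      because \<open>Y \<ge> 13000\<close>.\<close>
    have "- 2 * real T / N \<le> - ln K - 13"
    proof -
      define Y where "Y = (ln K + 13) * N"
      have "13 * 1000 \<le> Y" unfolding Y_def using lK N by (intro mult_mono) auto
      moreover have "X = 2503 / 5000 * Y" by (simp add: X_def Y_def)
      ultimately have "Y \<le> 2 * real T" using T by linarith
      then show ?thesis using N by (simp add: Y_def field_simps)
    qed
    then have "K * (2 * exp 7 * exp (- 2 * real T / N)) \<le> K * (2 * exp 7 * exp (- ln K - 13))"
      using K by (intro mult_left_mono) auto
    also have "\<dots> = 2 * exp (- 6)"
    proof -
      have "exp (- ln K - 13) = exp (- 13) / K" using K by (simp add: exp_diff exp_minus field_simps)
      moreover have "exp (7::real) * exp (- 13) = exp (- 6)" by (simp add: exp_add[symmetric])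
      ultimately show ?thesis using K by simp
    qed
    also have "\<dots> \<le> 2 / 64"
      using two_power_le_exp[of 6] by (simp add: exp_minus field_simps)
    finally have decay: "K * (2 * exp 7 * exp (- 2 * real T / N)) \<le> 2 / 64" .
    have "partial_mixing_time n (k n) (1 / 4) \<le> enat T"
      using elim(2) K(3) T2 collisions decay unfolding K_def N_def by (intro partial_mixing_time_le) auto
    then have "ereal_of_enat (partial_mixing_time n (k n) (1 / 4)) \<le> ereal_of_enat (enat T)"
      by (simp only: ereal_of_enat_le_iff)
    also have "\<dots> \<le> ereal X" using T by simp
    finally show ?case by (simp add: X_def K_def N_def)
  qed
qed

end
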